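(* Consider the sequence of single server queues $\{q_\eta(k):k\in\mathbb{Z}_+\}$, $\eta>0$, with infinite waiting area described in the context. Suppose there exist $\delta>0$ and $K>0$ such that $\phi^c(x)-\phi^s(x)<-\delta$ for all $x>K$. Suppose that for every $\eta>0$ the DTMC $\{q_\eta(k)\}$ is positive recurrent and let $\bar q_\eta$ denote its steady-state random variable. Then, as $\eta\uparrow\infty$: (1) If $\epsilon_\eta\tau_\eta\to0$, then $$\epsilon_\eta\bar q_\eta\overset{D}{\longrightarrow}\operatorname{Exp}\left(\frac{2}{\sigma^c(\lambda^\star)+\sigma^s(\mu^\star)}\right).$$ (2) If $\epsilon_\eta\tau_\eta\to l$ for some $l\in(0,\infty)$ and $\phi^c,\phi^s$ are infinitely differentiable on $\mathbb{R}$, then $$\epsilon_\eta\bar q_\eta\overset{D}{\longrightarrow}\operatorname{Gibbs}_+(g_{1,l}),\qquad g_{1,l}(t)=\frac{2}{\sigma^c(\lambda^\star)+\sigma^s(\mu^\star)}\left(\phi^s\!\left(\frac tl\right)-\phi^c\!\left(\frac tl\right)\right).$$ (3) If $\epsilon_\eta\tau_\eta\to\infty$ and $\phi^c$ is non-increasing, $\phi^s$ is non-decreasing, the set $\Phi^\star=\{x:\phi^c(x)-\phi^s(x)=0\}$ equals $[0,t^\star]$ for some $t^\star>0$, and $\phi^c(x)=\phi^s(x)=0$ for all $x\in\Phi^\star$, then $$\frac{\bar q_\eta}{\tau_\eta}\overset{D}{\longrightarrow}\operatorname{Uniform}([0,t^\star]).$$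
   Context: Model (single server queue with state-dependent arrivals and services). $\mathbb{Z}_+$ is the set of non-negative integers. For each $\eta>0$ let $\epsilon_\eta,\tau_\eta>0$. The queue length is the DTMC on $\mathbb{Z}_+$ $$q_\eta(k+1)=q_\eta(k)+a_\eta(q_\eta(k))-s_\eta(q_\eta(k))+u_\eta(q_\eta(k)),$$ where, in each time slot and given the current queue length $q$, the number of arrivals $a_\eta(q)$ and potential services $s_\eta(q)$ are $\mathbb{Z}_+$-valued, independent of each other and of the past, and $u_\eta$ is the unused service $u_\eta(q)=[s_\eta(q)-a_\eta(q)-q]^+$ (so that $q_\eta(k+1)u_\eta(q_\eta(k))=0$, i.e. $q_\eta(k+1)=[q_\eta(k)+a_\eta-s_\eta]^+$). The moments are $$E[a_\eta(q)]=\lambda_\eta(q)=\lambda^\star+\epsilon_\eta\phi^c(q/\tau_\eta),\quad \operatorname{Var}[a_\eta(q)]=\sigma^c(\lambda_\eta(q)),$$ $$E[s_\eta(q)]=\mu_\eta(q)=\mu^\star+\epsilon_\eta\phi^s(q/\tau_\eta),\quad \operatorname{Var}[s_\eta(q)]=\sigma^s(\mu_\eta(q)),$$ where $\phi^c,\phi^s:\mathbb{R}\to\mathbb{R}$ are Borel measurable and $\sigma^c,\sigma^s$ are continuous functions. Standing assumptions: $\lambda^\star=\mu^\star$; the limits $\phi^c(\infty),\phi^s(\infty)$ at $+\infty$ exist with $\phi^s(\infty)-\phi^c(\infty)=1$; there are constants $A_{\max},\sigma_{\max},\phi_{\max}>0$ with $a_\eta(q)\le A_{\max}$, $s_\eta(q)\le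 A_{\max}$ almost surely, $\sigma^c(\lambda_\eta(q)),\sigma^s(\mu_\eta(q))\le\sigma_{\max}$, and $|\phi^c|,|\phi^s|\le\phi_{\max}$ on $\mathbb{R}$. The DTMC is irreducible and aperiodic, and $\bar q_\eta$ has its stationary distribution. It is presupposed that $\sigma^c(\lambda^\star)+\sigma^s(\mu^\star)>0$. Asymptotic regime: as $\eta\uparrow\infty$, $\epsilon_\eta\to0$ and/or $\tau_\eta\to\infty$ (at least one holds). Distributions: $\operatorname{Exp}(\lambda)$ is the exponential distribution with rate $\lambda$; $\operatorname{Gibbs}_+(g)$ has density $e^{-\int_0^xg(t)dt}\mathbb{1}\{x\ge0\}\big/\int_0^\infty e^{-\int_0^ug(t)dt}du$; $\operatorname{Uniform}([0,t^\star])$ is the uniform distribution on $[0,t^\star]$. $\overset{D}{\to}$ is convergence in distribution. *)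

theory Defs
  imports "HOL-Probability.Probability"
begin

section \<open>Discrete-time Markov chains given by a transition kernel\<close>

primrec n_step :: "('a \<Rightarrow> 'a pmf) \<Rightarrow> nat \<Rightarrow> 'a \<Rightarrow> 'a pmf" where
  "n_step P 0 x = return_pmf x"
| "n_step P (Suc n) x = bind_pmf (P x) (n_step P n)"

definition irreducible_kernel :: "('a \<Rightarrow> 'a pmf) \<Rightarrow> bool" where
  "irreducible_kernel P \<longleftrightarrow> (\<forall>x y. \<exists>n. pmf (n_step P n x) y > 0)"

definition aperiodic_kernel :: "('a \<Rightarrow> 'a pmf) \<Rightarrow> bool" where
  "aperiodic_kernel P \<longleftrightarrow> (\<forall>x. Gcd {n::nat. n > 0 \<and> pmf (n_step P n x) x > 0} = 1)"

text \<open>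
  \<open>first_passage P y n x\<close> is the probability that the chain started in \<open>x\<close> visits \<open>y\<close>
  at time \<open>n\<close> and at no time in \<open>{1..<n}\<close>; time 0 does not count as a visit, so that
  \<open>first_passage P x n x\<close> is the distribution of the first return time to \<open>x\<close>.
\<close>
fun first_passage :: "('a \<Rightarrow> 'a pmf) \<Rightarrow> 'a \<Rightarrow> nat \<Rightarrow> 'a \<Rightarrow> real" where
  "first_passage P y 0 x = 0"
| "first_passage P y (Suc 0) x = pmf (P x) y"
| "first_passage P y (Suc (Suc n)) x =
     measure_pmf.expectation (P x) (\<lambda>z. if z = y then 0 else first_passage P y (Suc n) z)"

text \<open>The return to each state is almost surely finite and has finite mean.\<close>
definition positive_recurrent :: "('a \<Rightarrow> 'a pmf) \<Rightarrow> bool" where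
  "positive_recurrent P \<longleftrightarrow>
     (\<forall>x. (\<lambda>n. first_passage P x n x) sums 1 \<and>
          summable (\<lambda>n. real n * first_passage P x n x))"

definition stationary_distribution :: "('a \<Rightarrow> 'a pmf) \<Rightarrow> 'a pmf \<Rightarrow> bool" where
  "stationary_distribution P \<pi> \<longleftrightarrow> bind_pmf \<pi> P = \<pi>"

section \<open>The single server queue\<close>

definition unused_service :: "nat \<Rightarrow> nat \<Rightarrow> nat \<Rightarrow> nat" where
  "unused_service q a s = nat (int s - int a - int q)"

text \<open>The recursion is evaluated in the integers, where it yields a non-negative number.\<close>
definition queue_step :: "nat \<Rightarrow> nat \<Rightarrow> nat \<Rightarrow> nat" where
  "queue_step q a s = nat (int q + int a - int s + int (unused_service q a s))"

lemma int_queue_step: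
  "int (queue_step q a s) = int q + int a - int s + int (unused_service q a s)"
  by (simp add: queue_step_def unused_service_def)

lemma queue_step_eq: "queue_step q a s = q + a - s"
  unfolding queue_step_def unused_service_def by arith

text \<open>
  \<open>A q\<close> and \<open>S q\<close> are the laws of the arrivals and of the potential services in a slot that
  starts with queue length \<open>q\<close>.
\<close>
definition queue_kernel :: "(nat \<Rightarrow> nat pmf) \<Rightarrow> (nat \<Rightarrow> nat pmf) \<Rightarrow> nat \<Rightarrow> nat pmf" where
  "queue_kernel A S q = map_pmf (\<lambda>(a, s). queue_step q a s) (pair_pmf (A q) (S q))"

section \<open>Convergence in distribution and limit laws\<close>

text \<open>\<^const>\<open>weak_conv_m\<close> with an arbitrary index filter in place of \<^const>\<open>sequentially\<close>.\<close>
definition weak_conv_filter :: "('i \<Rightarrow> real measure) \<Rightarrow> real measure \<Rightarrow> 'i filter \<Rightarrow> bool" where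
  "weak_conv_filter M N F \<longleftrightarrow>
     (\<forall>x. isCont (cdf N) x \<longrightarrow> ((\<lambda>i. cdf (M i) x) \<longlongrightarrow> cdf N x) F)"

lemma weak_conv_filter_sequentially: "weak_conv_filter M N sequentially \<longleftrightarrow> weak_conv_m M N"
  by (simp add: weak_conv_filter_def weak_conv_m_def weak_conv_def)

definition exponential_law :: "real \<Rightarrow> real measure" where
  "exponential_law r = density lborel (\<lambda>x. ennreal (exponential_density r x))"

definition gibbs_density :: "(real \<Rightarrow> real) \<Rightarrow> real \<Rightarrow> real" where
  "gibbs_density g x =
     exp (- (LBINT t:{0..x}. g t)) * indicator {0..} x /
       (LBINT u:{0..}. exp (- (LBINT t:{0..u}. g t)))"

definition gibbs_law :: "(real \<Rightarrow> real) \<Rightarrow> real measure" where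
  "gibbs_law g = density lborel (\<lambda>x. ennreal (gibbs_density g x))"

definition infinitely_differentiable :: "(real \<Rightarrow> real) \<Rightarrow> bool" where
  "infinitely_differentiable f \<longleftrightarrow> (\<forall>n x. (deriv ^^ n) f differentiable (at x))"

end

theory Submission
  imports Defs
begin

text \<open>
  The limits are proved by Stein's method, applied directly to the stationary law. Let \<open>q\<close> be
  stationary, let \<open>a\<close>, \<open>s\<close> and \<open>u\<close> be the arrivals, the potential services and the unused service
  of one slot, and let \<open>X = r * q\<close> be the scaled queue length, with \<open>r = \<epsilon>\<close> in the first two
  regimes and \<open>r = 1 / \<tau>\<close> in the third. For a function \<open>f\<close> with derivatives \<open>f' = w\<close> and
  \<open>w' = v\<close>, stationarity says that \<open>f (X)\<close> has the same mean before and after the slot. A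
  second-order expansion of this identity contains the terms \<open>r * E [w (X) (a - s)]\<close> and
  \<open>r^2 / 2 * E [v (X) (a - s)^2]\<close> and a term for the reflection at zero. There is unused service
  only if \<open>X\<close> is of order \<open>r\<close>; hence, if \<open>w 0 = 0\<close>, the reflection costs no more than a
  multiple of \<open>r^2 * E [u]\<close>, and \<open>E [u] = E [s - a]\<close> tends to zero. So the difference of
  \<open>E [w (X) \<rho> (q)] / r\<close> and half of \<open>E [v (X) n (q)]\<close> tends to zero, where \<open>\<rho>\<close> is the conditional mean of \<open>s - a\<close> and \<open>n\<close>
  that of \<open>(a - s)^2\<close>. This is \<open>generator_estimate\<close>. The limits of \<open>\<rho> / r\<close> and \<open>n\<close>, say \<open>b (X)\<close>
  and \<open>2 c\<close>, then give \<open>E [c * v (X) - b (X) * w (X)] \<longlonglongrightarrow> 0\<close>.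

  In the first two regimes \<open>b\<close> is the constant \<open>1\<close>, respectively \<open>\<phi>s (x / l) - \<phi>c (x / l)\<close>. For a
  bounded \<open>h\<close> the equation \<open>c * v - b * w = h - N h\<close> with \<open>w 0 = 0\<close>, where \<open>N h\<close> is the mean of \<open>h\<close>
  under the Gibbs law of \<open>b / c\<close>, is solved by variation of constants. The solution is bounded
  because \<open>b\<close> is bounded below by a positive number far out (\<open>stein_equation\<close>), and it yields
  \<open>E [h (X)] \<longlonglongrightarrow> N h\<close> (\<open>queue_gibbs_limit\<close>). In the first regime the scaled surplus approaches \<open>1\<close>
  only away from the origin; as \<open>w\<close> vanishes there, this does no harm.

  In the third regime \<open>b\<close> is zero on \<open>[0, t]\<close> and infinite beyond \<open>t\<close>. The equation is now
  \<open>c * v = h - N h\<close> on \<open>[0, t]\<close> with the uniform law \<open>N\<close>, and its solution vanishes at both ends of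
  the interval. The drift beyond \<open>t\<close> is controlled as follows (\<open>queue_uniform_limit\<close>). A function
  with derivative \<open>max 0 (t - x)\<close> does not see the drift, so it bounds the unused service by
  \<open>O (1 / \<tau>)\<close> (\<open>expected_unused_le\<close>), and \<open>\<tau> * E [\<rho>]\<close> stays bounded; as \<open>\<epsilon> * \<tau>\<close> grows, mass
  beyond \<open>t + d\<close> disappears. The squared overshoot over a level between \<open>t\<close> and \<open>t + d\<close> then shows
  that the part of \<open>\<tau> * E [\<rho>]\<close> which comes from beyond \<open>t + d\<close> tends to zero
  (\<open>overshoot_tail\<close>). Together with \<open>w t = 0\<close> this removes the drift term.

  Stationarity alone gives no moment of \<open>q\<close>. The drift inequalities are therefore first derived for
  functions stopped at a finite level (\<open>truncated_drift\<close>), and integrability of \<open>q\<close> is one of their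
  consequences (\<open>integrable_queue\<close>).
\<close>


section \<open>Expectations under probability mass functions\<close>

lemma integrable_pmf_bounded:
  fixes f :: "'a \<Rightarrow> real"
  assumes "\<And>x. x \<in> set_pmf p \<Longrightarrow> \<bar>f x\<bar> \<le> B"
  shows "integrable (measure_pmf p) f"
  using assms by (intro measure_pmf.integrable_const_bound[where B=B]) (auto simp: AE_measure_pmf_iff)

lemma expectation_pmf_mono:
  fixes f g :: "'a \<Rightarrow> real"
  assumes "integrable (measure_pmf p) f" "integrable (measure_pmf p) g"
    and "\<And>x. x \<in> set_pmf p \<Longrightarrow> f x \<le> g x"
  shows "measure_pmf.expectation p f \<le> measure_pmf.expectation p g"
  using assms by (intro integral_mono_AE) (auto simp: AE_measure_pmf_iff)

lemma expectation_pmf_abs_le: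
  fixes f g :: "'a \<Rightarrow> real"
  assumes "integrable (measure_pmf p) g" "\<And>x. x \<in> set_pmf p \<Longrightarrow> \<bar>f x\<bar> \<le> g x"
  shows "\<bar>measure_pmf.expectation p f\<bar> \<le> measure_pmf.expectation p g"
proof -
  have i: "integrable (measure_pmf p) f"
    by (rule Bochner_Integration.integrable_bound[OF assms(1)])
       (use assms(2) in \<open>fastforce simp: AE_measure_pmf_iff\<close>)+
  have "\<bar>measure_pmf.expectation p f\<bar> \<le> measure_pmf.expectation p (\<lambda>x. \<bar>f x\<bar>)"
    using integral_norm_bound[of "measure_pmf p" f] by simp
  also have "\<dots> \<le> measure_pmf.expectation p g"
    using i assms by (intro expectation_pmf_mono) auto
  finally show ?thesis .
qed

text \<open>
  The bound is required on the support only: outside it \<open>f\<close> can be replaced by zero without changing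
  either side.
\<close>
lemma expectation_bind_pmf_bounded:
  fixes f :: "'b \<Rightarrow> real"
  assumes B: "\<And>x. x \<in> set_pmf (bind_pmf p k) \<Longrightarrow> \<bar>f x\<bar> \<le> B"
  shows "measure_pmf.expectation (bind_pmf p k) f =
    measure_pmf.expectation p (\<lambda>x. measure_pmf.expectation (k x) f)"
proof -
  define g where "g = (\<lambda>x. if x \<in> set_pmf (bind_pmf p k) then f x else 0)"
  have g: "\<bar>g x\<bar> \<le> \<bar>B\<bar>" for x
    using B[of x] by (cases "x \<in> set_pmf (bind_pmf p k)") (auto simp: g_def simp del: set_bind_pmf)
  have "measure_pmf.expectation (bind_pmf p k) f = measure_pmf.expectation (bind_pmf p k) g"
    by (intro integral_cong_AE) (auto simp: AE_measure_pmf_iff g_def)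
  also have "\<dots> = measure_pmf.expectation p (\<lambda>x. measure_pmf.expectation (k x) g)"
    unfolding measure_pmf_bind using measurable_measure_pmf[of k] g
    by (intro integral_bind[where K="count_space UNIV" and B="\<bar>B\<bar>" and B'=1])
       (auto simp: measure_pmf.emeasure_space_1 measure_pmf.finite_measure
             simp del: space_measure_pmf)
  also have "\<dots> = measure_pmf.expectation p (\<lambda>x. measure_pmf.expectation (k x) f)"
    by (intro integral_cong_AE) (auto simp: AE_measure_pmf_iff g_def intro!: integral_cong_AE)
  finally show ?thesis .
qed

lemma expectation_pair_pmf_mult:
  fixes f g :: "nat \<Rightarrow> real"
  assumes "\<And>x. x \<in> set_pmf p \<Longrightarrow> \<bar>f x\<bar> \<le> B" "\<And>y. y \<in> set_pmf q \<Longrightarrow> \<bar>g y\<bar> \<le> B"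
  shows "measure_pmf.expectation (pair_pmf p q) (\<lambda>(x, y). f x * g y) =
    measure_pmf.expectation p f * measure_pmf.expectation q g"
proof -
  have b: "\<bar>f x * g y\<bar> \<le> B * B" if "x \<in> set_pmf p" "y \<in> set_pmf q" for x y
    unfolding abs_mult using assms that by (intro mult_mono) (auto intro: order_trans[of _ "\<bar>f x\<bar>"])
  show ?thesis
    unfolding pair_pmf_def
    by (subst expectation_bind_pmf_bounded[where B="B * B"])
       (auto simp: b map_pmf_def[symmetric])
qed

text \<open>
  Independence of arrivals and services makes the variances add; the squared mean remains because
  the net input is not centred.
\<close>
lemma expectation_net_square:
  fixes p q :: "nat pmf"
  assumes "\<And>a. a \<in> set_pmf p \<Longrightarrow> real a \<le> M" "\<And>s. s \<in> set_pmf q \<Longrightarrow> real s \<le> M"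
  shows "measure_pmf.expectation (pair_pmf p q) (\<lambda>(a, s). (real a - real s)\<^sup>2) =
    measure_pmf.variance p real + measure_pmf.variance q real +
    (measure_pmf.expectation p real - measure_pmf.expectation q real)\<^sup>2"
proof -
  have ip: "integrable (measure_pmf p) real" "integrable (measure_pmf p) (\<lambda>a. (real a)\<^sup>2)"
    by (rule integrable_pmf_bounded[where B=M]; use assms in auto)
       (rule integrable_pmf_bounded[where B="M\<^sup>2"]; use assms in \<open>auto intro!: power_mono\<close>)
  have iq: "integrable (measure_pmf q) real" "integrable (measure_pmf q) (\<lambda>a. (real a)\<^sup>2)"
    by (rule integrable_pmf_bounded[where B=M]; use assms in auto)
       (rule integrable_pmf_bounded[where B="M\<^sup>2"]; use assms in \<open>auto intro!: power_mono\<close>)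
  have i1: "integrable (measure_pmf (pair_pmf p q)) (\<lambda>x. (real (fst x))\<^sup>2)"
    and i2: "integrable (measure_pmf (pair_pmf p q)) (\<lambda>x. (real (snd x))\<^sup>2)"
    and i3: "integrable (measure_pmf (pair_pmf p q)) (\<lambda>x. real (fst x) * real (snd x))"
  proof -
    show "integrable (measure_pmf (pair_pmf p q)) (\<lambda>x. (real (fst x))\<^sup>2)"
      by (rule integrable_pmf_bounded[where B="M\<^sup>2"]) (use assms in \<open>auto intro!: power_mono\<close>)
    show "integrable (measure_pmf (pair_pmf p q)) (\<lambda>x. (real (snd x))\<^sup>2)"
      by (rule integrable_pmf_bounded[where B="M\<^sup>2"]) (use assms in \<open>auto intro!: power_mono\<close>)
    show "integrable (measure_pmf (pair_pmf p q)) (\<lambda>x. real (fst x) * real (snd x))"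
      by (rule integrable_pmf_bounded[where B="M * M"])
         (use assms in \<open>auto intro!: mult_mono intro: order_trans[OF of_nat_0_le_iff]\<close>)
  qed
  have "measure_pmf.expectation (pair_pmf p q) (\<lambda>(a, s). (real a - real s)\<^sup>2) =
    measure_pmf.expectation (pair_pmf p q)
      (\<lambda>x. (real (fst x))\<^sup>2 - 2 * (real (fst x) * real (snd x)) + (real (snd x))\<^sup>2)"
    by (intro arg_cong[where f="measure_pmf.expectation _"]) (auto simp: power2_eq_square algebra_simps)
  also have "\<dots> = measure_pmf.expectation (pair_pmf p q) (\<lambda>x. (real (fst x))\<^sup>2)
      - 2 * measure_pmf.expectation (pair_pmf p q) (\<lambda>x. real (fst x) * real (snd x))
      + measure_pmf.expectation (pair_pmf p q) (\<lambda>x. (real (snd x))\<^sup>2)"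
    using i1 i2 i3 by simp
  also have "measure_pmf.expectation (pair_pmf p q) (\<lambda>x. real (fst x) * real (snd x)) =
      measure_pmf.expectation p real * measure_pmf.expectation q real"
    using expectation_pair_pmf_mult[of p real M q real] assms by (simp add: case_prod_unfold)
  also have "measure_pmf.expectation (pair_pmf p q) (\<lambda>x. (real (fst x))\<^sup>2) =
      measure_pmf.expectation p (\<lambda>a. (real a)\<^sup>2)"
    by (rule expectation_pair_pmf_fst[where f="\<lambda>a. (real a)\<^sup>2"])
  also have "measure_pmf.expectation (pair_pmf p q) (\<lambda>x. (real (snd x))\<^sup>2) =
      measure_pmf.expectation q (\<lambda>a. (real a)\<^sup>2)"
    by (rule expectation_pair_pmf_snd[where f="\<lambda>a. (real a)\<^sup>2"])
  finally show ?thesis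
    using measure_pmf.variance_eq[OF ip] measure_pmf.variance_eq[OF iq]
    by (simp add: power2_eq_square algebra_simps)
qed

section \<open>One slot of a stationary queue\<close>

text \<open>
  A single queue in equilibrium, without any scaling: the asymptotic statements instantiate the locale
  once for each value of the scaling parameter, with the same bound \<open>M\<close>.
\<close>
locale stationary_queue =
  fixes A S :: "nat \<Rightarrow> nat pmf" and \<pi> :: "nat pmf" and M :: real
  assumes arrival_le: "a \<in> set_pmf (A q) \<Longrightarrow> real a \<le> M"
    and service_le: "s \<in> set_pmf (S q) \<Longrightarrow> real s \<le> M"
    and stationary: "stationary_distribution (queue_kernel A S) \<pi>"
begin

definition service_surplus :: "nat \<Rightarrow> real" where
  "service_surplus q = measure_pmf.expectation (S q) real - measure_pmf.expectation (A q) real"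

definition net_square :: "nat \<Rightarrow> real" where
  "net_square q = measure_pmf.expectation (pair_pmf (A q) (S q)) (\<lambda>(a, s). (real a - real s)\<^sup>2)"

text \<open>
  The joint law of queue length, arrivals and potential services in a slot that starts in
  equilibrium. Expectations over it can be taken of unbounded functions of the queue length, since
  they transfer along the two marginal maps \<open>map_slot_queue\<close> and \<open>map_slot_next\<close>.
\<close>
definition slot :: "(nat \<times> nat \<times> nat) pmf" where
  "slot = bind_pmf \<pi> (\<lambda>q. map_pmf (Pair q) (pair_pmf (A q) (S q)))"

definition queue :: "nat \<times> nat \<times> nat \<Rightarrow> real" where
  "queue = (\<lambda>(q, a, s). real q)"

definition net :: "nat \<times> nat \<times> nat \<Rightarrow> real" where
  "net = (\<lambda>(q, a, s). real a - real s)"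

definition unused :: "nat \<times> nat \<times> nat \<Rightarrow> real" where
  "unused = (\<lambda>(q, a, s). real (unused_service q a s))"

lemma M_nonneg: "0 \<le> M"
proof -
  obtain a where "a \<in> set_pmf (A 0)" using set_pmf_not_empty by fast
  from arrival_le[OF this] show ?thesis by linarith
qed

text \<open>
  The increment \<open>net + unused\<close> is the maximum of \<open>net\<close> and minus the queue length, hence bounded like
  \<open>net\<close> itself; and service is wasted only when the queue is too short to absorb it.
\<close>
lemma slot_bounds:
  assumes "\<omega> \<in> set_pmf slot"
  shows "\<bar>net \<omega>\<bar> \<le> M" "0 \<le> unused \<omega>" "unused \<omega> \<le> M" "\<bar>net \<omega> + unused \<omega>\<bar> \<le> M"
    "unused \<omega> \<noteq> 0 \<Longrightarrow> queue \<omega> \<le> M" "0 \<le> queue \<omega>" "0 \<le> queue \<omega> + net \<omega> + unused \<omega>"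
proof -
  obtain q a s where \<omega>: "\<omega> = (q, a, s)" and "a \<in> set_pmf (A q)" "s \<in> set_pmf (S q)"
    using assms by (auto simp: slot_def)
  then have a: "real a \<le> M" and s: "real s \<le> M"
    using arrival_le service_le by auto
  have u: "real (unused_service q a s) = max 0 (real s - real a - real q)"
    unfolding unused_service_def by (auto simp: max_def)
  show "\<bar>net \<omega>\<bar> \<le> M" "0 \<le> unused \<omega>" "unused \<omega> \<le> M" "\<bar>net \<omega> + unused \<omega>\<bar> \<le> M"
    "unused \<omega> \<noteq> 0 \<Longrightarrow> queue \<omega> \<le> M" "0 \<le> queue \<omega>" "0 \<le> queue \<omega> + net \<omega> + unused \<omega>"
    using a s unfolding \<omega> net_def unused_def queue_def by (auto simp: u max_def split: if_splits)
qed

lemma expectation_slot: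
  fixes f :: "nat \<times> nat \<times> nat \<Rightarrow> real"
  assumes "\<And>\<omega>. \<omega> \<in> set_pmf slot \<Longrightarrow> \<bar>f \<omega>\<bar> \<le> B"
  shows "measure_pmf.expectation slot f =
    measure_pmf.expectation \<pi> (\<lambda>q. measure_pmf.expectation (pair_pmf (A q) (S q)) (\<lambda>x. f (q, x)))"
  unfolding slot_def
  by (subst expectation_bind_pmf_bounded[where B=B]) (use assms in \<open>auto simp: slot_def\<close>)

lemma map_slot_queue: "map_pmf fst slot = \<pi>"
  by (simp add: slot_def map_bind_pmf map_pmf_comp bind_return_pmf')

lemma map_slot_next: "map_pmf (\<lambda>(q, a, s). queue_step q a s) slot = \<pi>"
  using stationary
  by (simp add: slot_def map_bind_pmf map_pmf_comp stationary_distribution_def queue_kernel_def[abs_def]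
      case_prod_unfold)

lemma queue_step_slot:
  "real (queue_step q a s) = queue (q, a, s) + net (q, a, s) + unused (q, a, s)"
  using int_queue_step[of q a s] by (simp add: queue_def net_def unused_def)

lemma expectation_slot_queue:
  fixes g :: "real \<Rightarrow> real"
  shows "measure_pmf.expectation slot (\<lambda>\<omega>. g (queue \<omega>)) = measure_pmf.expectation \<pi> (\<lambda>q. g (real q))"
    "integrable (measure_pmf slot) (\<lambda>\<omega>. g (queue \<omega>)) \<longleftrightarrow> integrable (measure_pmf \<pi>) (\<lambda>q. g (real q))"
  by (subst (2) map_slot_queue[symmetric], simp add: queue_def case_prod_unfold)+

lemma expectation_slot_next:
  fixes g :: "real \<Rightarrow> real"
  shows "measure_pmf.expectation slot (\<lambda>\<omega>. g (queue \<omega> + net \<omega> + unused \<omega>)) =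
      measure_pmf.expectation \<pi> (\<lambda>q. g (real q))"
    "integrable (measure_pmf slot) (\<lambda>\<omega>. g (queue \<omega> + net \<omega> + unused \<omega>)) \<longleftrightarrow>
      integrable (measure_pmf \<pi>) (\<lambda>q. g (real q))"
proof -
  have *: "(\<lambda>\<omega>. g (queue \<omega> + net \<omega> + unused \<omega>)) = (\<lambda>\<omega>. g (real ((\<lambda>(q, a, s). queue_step q a s) \<omega>)))"
    by (auto simp: queue_step_slot)
  show "measure_pmf.expectation slot (\<lambda>\<omega>. g (queue \<omega> + net \<omega> + unused \<omega>)) =
      measure_pmf.expectation \<pi> (\<lambda>q. g (real q))"
    unfolding * by (subst (2) map_slot_next[symmetric]) simp
  show "integrable (measure_pmf slot) (\<lambda>\<omega>. g (queue \<omega> + net \<omega> + unused \<omega>)) \<longleftrightarrow>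
      integrable (measure_pmf \<pi>) (\<lambda>q. g (real q))"
    unfolding * by (subst (2) map_slot_next[symmetric]) simp
qed

lemma expectation_net:
  fixes g :: "real \<Rightarrow> real"
  assumes g: "\<And>q. \<bar>g (real q)\<bar> \<le> B"
  shows "measure_pmf.expectation slot (\<lambda>\<omega>. g (queue \<omega>) * net \<omega>) =
      - measure_pmf.expectation \<pi> (\<lambda>q. g (real q) * service_surplus q)"
    "measure_pmf.expectation slot (\<lambda>\<omega>. g (queue \<omega>) * (net \<omega>)\<^sup>2) =
      measure_pmf.expectation \<pi> (\<lambda>q. g (real q) * net_square q)"
proof -
  have B: "0 \<le> B" using g[of 0] by linarith
  have b1: "\<bar>g (queue \<omega>) * net \<omega>\<bar> \<le> B * M" if "\<omega> \<in> set_pmf slot" for \<omega>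
    unfolding abs_mult using g slot_bounds[OF that] B
    by (intro mult_mono) (auto simp: queue_def split: prod.splits)
  have b2: "\<bar>g (queue \<omega>) * (net \<omega>)\<^sup>2\<bar> \<le> B * M\<^sup>2" if "\<omega> \<in> set_pmf slot" for \<omega>
    unfolding abs_mult using g slot_bounds[OF that] B
    by (intro mult_mono) (auto simp: queue_def abs_le_square_iff[symmetric] split: prod.splits)
  have e: "measure_pmf.expectation (pair_pmf (A q) (S q)) (\<lambda>x. real (fst x) - real (snd x)) =
    - service_surplus q" for q
  proof -
    have "integrable (measure_pmf (pair_pmf (A q) (S q))) (\<lambda>x. real (fst x))"
      "integrable (measure_pmf (pair_pmf (A q) (S q))) (\<lambda>x. real (snd x))"
      using arrival_le service_le by (auto intro!: integrable_pmf_bounded[where B=M])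
    then show ?thesis
      using expectation_pair_pmf_fst[of "A q" "S q" real] expectation_pair_pmf_snd[of "A q" "S q" real]
      by (simp add: service_surplus_def)
  qed
  show "measure_pmf.expectation slot (\<lambda>\<omega>. g (queue \<omega>) * net \<omega>) =
      - measure_pmf.expectation \<pi> (\<lambda>q. g (real q) * service_surplus q)"
    by (subst expectation_slot[OF b1]) (auto simp: queue_def net_def case_prod_unfold e)
  show "measure_pmf.expectation slot (\<lambda>\<omega>. g (queue \<omega>) * (net \<omega>)\<^sup>2) =
      measure_pmf.expectation \<pi> (\<lambda>q. g (real q) * net_square q)"
    by (subst expectation_slot[OF b2]) (auto simp: queue_def net_def case_prod_unfold net_square_def)
qed

lemma service_surplus_bound: "\<bar>service_surplus q\<bar> \<le> M"
proof -
  have *: "0 \<le> measure_pmf.expectation p real \<and> measure_pmf.expectation p real \<le> M"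
    if "\<forall>a \<in> set_pmf p. real a \<le> M" for p
    using that expectation_pmf_mono[of p real "\<lambda>_. M"] integrable_pmf_bounded[of p real M]
    by (auto intro: integral_nonneg_AE)
  show ?thesis
  proof -
    have "0 \<le> measure_pmf.expectation (A q) real \<and> measure_pmf.expectation (A q) real \<le> M"
      "0 \<le> measure_pmf.expectation (S q) real \<and> measure_pmf.expectation (S q) real \<le> M"
      by (rule *, use arrival_le service_le in blast)+
    then show ?thesis unfolding service_surplus_def by linarith
  qed
qed

lemma net_square_eq:
  "net_square q = measure_pmf.variance (A q) real + measure_pmf.variance (S q) real +
    (service_surplus q)\<^sup>2"
  unfolding net_square_def service_surplus_def
  by (subst expectation_net_square[where M=M])
     (use arrival_le service_le in \<open>auto simp: power2_eq_square algebra_simps\<close>)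

lemma net_square_bound: "0 \<le> net_square q" "net_square q \<le> M\<^sup>2"
proof -
  have "\<bar>net_square q\<bar> \<le> M\<^sup>2"
  proof -
    have "\<bar>(real (fst x) - real (snd x))\<^sup>2\<bar> \<le> M\<^sup>2" if "x \<in> set_pmf (pair_pmf (A q) (S q))" for x
      using that arrival_le[of "fst x" q] service_le[of "snd x" q] 
      by (auto simp: abs_le_square_iff[symmetric])
    then show ?thesis
      using expectation_pmf_abs_le[of "pair_pmf (A q) (S q)" "\<lambda>_. M\<^sup>2" "\<lambda>x. (real (fst x) - real (snd x))\<^sup>2"]
      by (simp add: net_square_def case_prod_unfold)
  qed
  then show "net_square q \<le> M\<^sup>2" by simp
  show "0 \<le> net_square q"
    unfolding net_square_def by (intro integral_nonneg_AE) (auto)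
qed

end

section \<open>Drift inequalities\<close>

context stationary_queue
begin

text \<open>
  Foster's inequality without any moment assumption. The bounded function \<open>V (min x m)\<close> has equal means
  before and after a slot. From a state at or above \<open>m\<close> it can only decrease, and from a state below
  \<open>m\<close> it increases by at most as much as \<open>V\<close>.
\<close>
lemma truncated_drift:
  fixes V :: "real \<Rightarrow> real" and m :: real
  assumes mono: "\<And>x y. 0 \<le> x \<Longrightarrow> x \<le> y \<Longrightarrow> V x \<le> V y" and m: "0 \<le> m"
  shows "0 \<le> measure_pmf.expectation slot
    (\<lambda>\<omega>. indicator {..<m} (queue \<omega>) * (V (queue \<omega> + net \<omega> + unused \<omega>) - V (queue \<omega>)))"
proof -
  define W where "W = (\<lambda>x. V (min x m))"
  have W: "\<bar>W x\<bar> \<le> \<bar>V 0\<bar> + \<bar>V m\<bar>" if "0 \<le> x" for x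
    using mono[of 0 "min x m"] mono[of "min x m" m] that m unfolding W_def by auto
  have iq: "integrable (measure_pmf \<pi>) (\<lambda>q. W (real q))"
    using W by (intro integrable_pmf_bounded[where B="\<bar>V 0\<bar> + \<bar>V m\<bar>"]) auto
  have "measure_pmf.expectation slot (\<lambda>\<omega>. W (queue \<omega> + net \<omega> + unused \<omega>) - W (queue \<omega>)) = 0"
    using iq by (simp add: expectation_slot_next expectation_slot_queue)
  moreover have "measure_pmf.expectation slot (\<lambda>\<omega>. W (queue \<omega> + net \<omega> + unused \<omega>) - W (queue \<omega>))
    \<le> measure_pmf.expectation slot
      (\<lambda>\<omega>. indicator {..<m} (queue \<omega>) * (V (queue \<omega> + net \<omega> + unused \<omega>) - V (queue \<omega>)))"
  proof (rule expectation_pmf_mono)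
    show "integrable (measure_pmf slot) (\<lambda>\<omega>. W (queue \<omega> + net \<omega> + unused \<omega>) - W (queue \<omega>))"
      using iq by (simp add: expectation_slot_next expectation_slot_queue)
    show "integrable (measure_pmf slot)
      (\<lambda>\<omega>. indicator {..<m} (queue \<omega>) * (V (queue \<omega> + net \<omega> + unused \<omega>) - V (queue \<omega>)))"
    proof (rule integrable_pmf_bounded)
      fix \<omega> assume \<omega>: "\<omega> \<in> set_pmf slot"
      note b = slot_bounds[OF \<omega>]
      show "\<bar>indicator {..<m} (queue \<omega>) * (V (queue \<omega> + net \<omega> + unused \<omega>) - V (queue \<omega>))\<bar> \<le> V (m + M) - V 0"
      proof (cases "queue \<omega> < m")
        case True
        then have "V 0 \<le> V (queue \<omega>)" "V (queue \<omega>) \<le> V (m + M)"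
          "V 0 \<le> V (queue \<omega> + net \<omega> + unused \<omega>)" "V (queue \<omega> + net \<omega> + unused \<omega>) \<le> V (m + M)"
          using b M_nonneg by (auto intro!: mono)
        then show ?thesis using True by simp
      next
        case False
        then show ?thesis using mono[of 0 "m + M"] m M_nonneg by simp
      qed
    qed
    fix \<omega> assume \<omega>: "\<omega> \<in> set_pmf slot"
    note b = slot_bounds[OF \<omega>]
    show "W (queue \<omega> + net \<omega> + unused \<omega>) - W (queue \<omega>) \<le>
      indicator {..<m} (queue \<omega>) * (V (queue \<omega> + net \<omega> + unused \<omega>) - V (queue \<omega>))"
      using mono[of "min (queue \<omega> + net \<omega> + unused \<omega>) m" m]
        mono[of "min (queue \<omega> + net \<omega> + unused \<omega>) m" "queue \<omega> + net \<omega> + unused \<omega>"] b m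
      by (auto simp: W_def min_absorb2 min_absorb1 split: split_indicator)
  qed
  ultimately show ?thesis by simp
qed

text \<open>
  The drift of the squared overshoot over \<open>N\<close>. The square of \<open>max 0 (x - N)\<close> grows by at most
  \<open>2 * max 0 (x - N) * d + d^2\<close> when \<open>x\<close> grows by \<open>d\<close>, and by nothing if the queue stays below \<open>N\<close>,
  which it does if it starts below \<open>N - M\<close>. The constant \<open>3 * M^2\<close> consists of \<open>M^2\<close> for \<open>d^2\<close> and
  \<open>2 * M^2\<close> for the unused service, which occurs at queue lengths up to \<open>M\<close>.
\<close>
lemma overshoot_drift:
  assumes N: "0 \<le> N" and m: "0 \<le> m"
  shows "measure_pmf.expectation \<pi>
      (\<lambda>q. indicator {..<m} (real q) * (2 * max 0 (real q - N)) * service_surplus q) \<le>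
    3 * M\<^sup>2 * measure_pmf.prob \<pi> {q. N - M < real q}"
proof -
  define g where "g = (\<lambda>x::real. indicator {..<m} x * (2 * max 0 (x - N)))"
  have g: "\<bar>g (real q)\<bar> \<le> 2 * m" for q
    using N m by (auto simp: g_def split: split_indicator)
  define V where "V = (\<lambda>x. (max 0 (x - N))\<^sup>2)"
  have "0 \<le> measure_pmf.expectation slot
    (\<lambda>\<omega>. indicator {..<m} (queue \<omega>) * (V (queue \<omega> + net \<omega> + unused \<omega>) - V (queue \<omega>)))"
    by (rule truncated_drift[OF _ m]) (auto simp: V_def intro!: power_mono)
  also have "\<dots> \<le> measure_pmf.expectation slot
    (\<lambda>\<omega>. g (queue \<omega>) * net \<omega> + 3 * M\<^sup>2 * indicator {N - M<..} (queue \<omega>))"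
  proof -
    have le: "indicator {..<m} (queue \<omega>) * (V (queue \<omega> + net \<omega> + unused \<omega>) - V (queue \<omega>)) \<le>
        g (queue \<omega>) * net \<omega> + 3 * M\<^sup>2 * indicator {N - M<..} (queue \<omega>)"
      and bd: "\<bar>indicator {..<m} (queue \<omega>) * (V (queue \<omega> + net \<omega> + unused \<omega>) - V (queue \<omega>))\<bar> \<le>
        (m + M)\<^sup>2"
      and bd2: "\<bar>g (queue \<omega>) * net \<omega> + 3 * M\<^sup>2 * indicator {N - M<..} (queue \<omega>)\<bar> \<le> 2 * m * M + 3 * M\<^sup>2"
      if "\<omega> \<in> set_pmf slot" for \<omega>
    proof -
      note b = slot_bounds[OF that]
      define z where "z = max 0 (queue \<omega> - N)"
      define d where "d = net \<omega> + unused \<omega>"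
      have d: "\<bar>d\<bar> \<le> M" using b by (simp add: d_def)
      then have d2: "d\<^sup>2 \<le> M\<^sup>2" by (simp add: abs_le_square_iff[symmetric])
      have up: "V (queue \<omega> + net \<omega> + unused \<omega>) - V (queue \<omega>) \<le> 2 * z * d + d\<^sup>2"
      proof -
        have "V (queue \<omega> + net \<omega> + unused \<omega>) \<le> (z + d)\<^sup>2"
          unfolding V_def abs_le_square_iff[symmetric] by (auto simp: z_def d_def)
        moreover have "V (queue \<omega>) = z\<^sup>2" by (simp add: V_def z_def)
        ultimately show ?thesis by (simp add: power2_sum)
      qed
      show "indicator {..<m} (queue \<omega>) * (V (queue \<omega> + net \<omega> + unused \<omega>) - V (queue \<omega>)) \<le>
        g (queue \<omega>) * net \<omega> + 3 * M\<^sup>2 * indicator {N - M<..} (queue \<omega>)"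
      proof (cases "queue \<omega> < m \<and> N - M < queue \<omega>")
        case True
        have "z * unused \<omega> \<le> M * M"
          using b N M_nonneg by (cases "unused \<omega> = 0") (auto simp: z_def intro!: mult_mono)
        then show ?thesis
          using True up d2 by (simp add: g_def z_def[symmetric] d_def algebra_simps power2_eq_square)
      next
        case False
        then show ?thesis
          using d by (auto simp: g_def V_def d_def split: split_indicator)
      qed
      show "\<bar>indicator {..<m} (queue \<omega>) * (V (queue \<omega> + net \<omega> + unused \<omega>) - V (queue \<omega>))\<bar> \<le> (m + M)\<^sup>2"
      proof (cases "queue \<omega> < m")
        case True
        then have "V (queue \<omega>) \<le> (m + M)\<^sup>2" "V (queue \<omega> + net \<omega> + unused \<omega>) \<le> (m + M)\<^sup>2"
          using b N m M_nonneg by (auto simp: V_def intro!: power_mono)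
        moreover have "0 \<le> V (queue \<omega>)" "0 \<le> V (queue \<omega> + net \<omega> + unused \<omega>)"
          by (auto simp: V_def)
        ultimately show ?thesis using True by simp
      qed simp
      have "\<bar>g (queue \<omega>)\<bar> * \<bar>net \<omega>\<bar> \<le> 2 * m * M"
        using b g[of "fst \<omega>"] m by (intro mult_mono) (auto simp: queue_def case_prod_unfold)
      then show "\<bar>g (queue \<omega>) * net \<omega> + 3 * M\<^sup>2 * indicator {N - M<..} (queue \<omega>)\<bar> \<le> 2 * m * M + 3 * M\<^sup>2"
        unfolding abs_mult[symmetric] using zero_le_power2[of M]
        by (cases "N - M < queue \<omega>"; simp; linarith)
    qed
    show ?thesis
      by (rule expectation_pmf_mono[OF integrable_pmf_bounded integrable_pmf_bounded le])
         (rule bd bd2; assumption)+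
  qed
  also have "\<dots> = - measure_pmf.expectation \<pi> (\<lambda>q. g (real q) * service_surplus q) +
     3 * M\<^sup>2 * measure_pmf.prob \<pi> {q. N - M < real q}"
  proof -
    have "integrable (measure_pmf slot) (\<lambda>\<omega>. g (queue \<omega>) * net \<omega>)"
    proof (rule integrable_pmf_bounded)
      fix \<omega> assume "\<omega> \<in> set_pmf slot"
      from slot_bounds[OF this] show "\<bar>g (queue \<omega>) * net \<omega>\<bar> \<le> 2 * m * M"
        using g[of "fst \<omega>"] m unfolding abs_mult
        by (intro mult_mono) (auto simp: queue_def case_prod_unfold)
    qed
    moreover have "measure_pmf.expectation slot (\<lambda>\<omega>. indicator {N - M<..} (queue \<omega>) :: real) =
      measure_pmf.prob \<pi> {q. N - M < real q}"
    proof -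
      have "(\<lambda>q. indicator {N - M<..} (real q) :: real) = indicator {q. N - M < real q}"
        by (auto simp: indicator_def)
      then show ?thesis by (subst expectation_slot_queue) simp
    qed
    moreover have "integrable (measure_pmf slot) (\<lambda>\<omega>. indicator {N - M<..} (queue \<omega>) :: real)"
      by (rule integrable_pmf_bounded[where B=1]) (auto simp: indicator_def)
    ultimately show ?thesis by (simp add: expectation_net[of g, OF g])
  qed
  finally show ?thesis by (simp add: g_def)
qed

text \<open>
  Beyond \<open>N + D\<close> the overshoot is at least \<open>D\<close>, so it can be replaced by this constant. The gain over a
  bound by Markov's inequality is the probability on the right, which makes the surplus far above a
  level negligible as soon as the queue rarely exceeds that level.
\<close>
lemma overshoot_tail:
  assumes N: "0 \<le> N" and D: "0 \<le> D" and surplus: "\<And>q. N \<le> real q \<Longrightarrow> 0 \<le> service_surplus q"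
  shows "2 * D * measure_pmf.expectation \<pi> (\<lambda>q. service_surplus q * indicator {N + D..} (real q)) \<le>
    3 * M\<^sup>2 * measure_pmf.prob \<pi> {q. N - M < real q}"
proof -
  let ?f = "\<lambda>q. service_surplus q * indicator {N + D..} (real q)"
  have bound: "\<bar>?f q\<bar> \<le> M" for q
    using service_surplus_bound[of q] M_nonneg by (auto split: split_indicator)
  have "(\<lambda>m. 2 * D * measure_pmf.expectation \<pi> (\<lambda>q. indicator {..<real m} (real q) * ?f q))
    \<longlonglongrightarrow> 2 * D * measure_pmf.expectation \<pi> ?f"
  proof (intro tendsto_mult_left integral_dominated_convergence)
    show "integrable (measure_pmf \<pi>) (\<lambda>_. M)" by simp
    show "AE q in measure_pmf \<pi>. (\<lambda>m. indicator {..<real m} (real q) * ?f q) \<longlonglongrightarrow> ?f q"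
    proof (rule AE_I2)
      fix q
      have "\<forall>\<^sub>F m in sequentially. indicator {..<real m} (real q) * ?f q = ?f q"
        using eventually_gt_at_top[of q] by eventually_elim simp
      then show "(\<lambda>m. indicator {..<real m} (real q) * ?f q) \<longlonglongrightarrow> ?f q" by (rule tendsto_eventually)
    qed
    show "AE q in measure_pmf \<pi>. norm (indicator {..<real m} (real q) * ?f q) \<le> M" for m
      using bound M_nonneg by (auto simp: indicator_def)
  qed auto
  moreover have "2 * D * measure_pmf.expectation \<pi> (\<lambda>q. indicator {..<real m} (real q) * ?f q) \<le>
      3 * M\<^sup>2 * measure_pmf.prob \<pi> {q. N - M < real q}" for m
  proof -
    have "2 * D * measure_pmf.expectation \<pi> (\<lambda>q. indicator {..<real m} (real q) * ?f q) =
        measure_pmf.expectation \<pi> (\<lambda>q. 2 * D * (indicator {..<real m} (real q) * ?f q))"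
      by simp
    also have "\<dots> \<le> measure_pmf.expectation \<pi>
        (\<lambda>q. indicator {..<real m} (real q) * (2 * max 0 (real q - N)) * service_surplus q)"
    proof (rule expectation_pmf_mono)
      show "integrable (measure_pmf \<pi>) (\<lambda>q. 2 * D * (indicator {..<real m} (real q) * ?f q))"
        using bound M_nonneg
        by (intro integrable_mult_right integrable_pmf_bounded[where B=M]) (auto split: split_indicator)
      show "integrable (measure_pmf \<pi>)
          (\<lambda>q. indicator {..<real m} (real q) * (2 * max 0 (real q - N)) * service_surplus q)"
      proof (rule integrable_pmf_bounded)
        fix q
        have "\<bar>indicator {..<real m} (real q) * (2 * max 0 (real q - N))\<bar> * \<bar>service_surplus q\<bar> \<le> 2 * real m * M"
          using service_surplus_bound[of q] N M_nonneg
          by (intro mult_mono) (auto split: split_indicator)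
        then show "\<bar>indicator {..<real m} (real q) * (2 * max 0 (real q - N)) * service_surplus q\<bar> \<le> 2 * real m * M"
          by (simp only: abs_mult)
      qed
      fix q
      show "2 * D * (indicator {..<real m} (real q) * ?f q) \<le>
        indicator {..<real m} (real q) * (2 * max 0 (real q - N)) * service_surplus q"
      proof (cases "N \<le> real q")
        case True
        then show ?thesis using surplus[OF True] D
          by (auto split: split_indicator intro!: mult_right_mono)
      next
        case False
        then show ?thesis using N D by (auto split: split_indicator)
      qed
    qed
    also have "\<dots> \<le> 3 * M\<^sup>2 * measure_pmf.prob \<pi> {q. N - M < real q}"
      by (rule overshoot_drift[OF N]) simp
    finally show ?thesis .
  qed
  ultimately show ?thesis using LIMSEQ_le_const2 by blast
qed

text \<open>
  In equilibrium the mean queue length does not change, so whatever mean service exceeds mean arrivals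
  is wasted.
\<close>
lemma expected_unused:
  assumes "integrable (measure_pmf \<pi>) real"
  shows "measure_pmf.expectation slot unused = measure_pmf.expectation \<pi> service_surplus"
proof -
  have i: "integrable (measure_pmf slot) queue" "integrable (measure_pmf slot) (\<lambda>\<omega>. queue \<omega> + net \<omega> + unused \<omega>)"
    "integrable (measure_pmf slot) net" "integrable (measure_pmf slot) unused"
    using assms expectation_slot_queue(2)[of "\<lambda>x. x"] expectation_slot_next(2)[of "\<lambda>x. x"] slot_bounds
    by (auto intro!: integrable_pmf_bounded[where B=M])
  have "measure_pmf.expectation slot (\<lambda>\<omega>. queue \<omega> + net \<omega> + unused \<omega>) =
    measure_pmf.expectation slot queue"
    using expectation_slot_queue(1)[of "\<lambda>x. x"] expectation_slot_next(1)[of "\<lambda>x. x"] by simp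
  moreover have "measure_pmf.expectation slot net = - measure_pmf.expectation \<pi> service_surplus"
    using expectation_net(1)[of "\<lambda>_. 1" 1] by simp
  ultimately show ?thesis using i by simp
qed

text \<open>
  With \<open>N = 0\<close> the overshoot is the queue length itself. A surplus of at least \<open>\<kappa>\<close> beyond \<open>q0\<close> turns the
  drift inequality into a bound on the mean of the queue length below \<open>m\<close> that does not depend on
  \<open>m\<close>, and monotone convergence applies.
\<close>
lemma integrable_queue:
  assumes \<kappa>: "0 < \<kappa>" and surplus: "\<And>q. q0 \<le> real q \<Longrightarrow> \<kappa> \<le> service_surplus q"
  shows "integrable (measure_pmf \<pi>) real"
proof -
  define C where "C = (3 * M\<^sup>2 / 2 + (\<kappa> + M) * \<bar>q0\<bar>) / \<kappa>"
  have bound: "measure_pmf.expectation \<pi> (\<lambda>q. indicator {..<real m} (real q) * real q) \<le> C" for m :: nat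
  proof -
    let ?i = "\<lambda>q. indicator {..<real m} (real q) :: real"
    have "measure_pmf.expectation \<pi> (\<lambda>q. ?i q * (2 * max 0 (real q - 0)) * service_surplus q) \<le>
      3 * M\<^sup>2 * measure_pmf.prob \<pi> {q. 0 - M < real q}"
      by (rule overshoot_drift) auto
    also have "\<dots> \<le> 3 * M\<^sup>2 * 1" by (intro mult_left_mono) auto
    finally have 1: "measure_pmf.expectation \<pi> (\<lambda>q. ?i q * (2 * real q) * service_surplus q) \<le> 3 * M\<^sup>2"
      by simp
    have i1: "integrable (measure_pmf \<pi>) (\<lambda>q. ?i q * (2 * real q) * service_surplus q)"
    proof (rule integrable_pmf_bounded)
      fix q
      have "\<bar>?i q * (2 * real q)\<bar> * \<bar>service_surplus q\<bar> \<le> (2 * real m) * M"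
        using service_surplus_bound[of q] by (intro mult_mono) (auto split: split_indicator)
      then show "\<bar>?i q * (2 * real q) * service_surplus q\<bar> \<le> (2 * real m) * M" by (simp add: abs_mult)
    qed
    have i2: "integrable (measure_pmf \<pi>) (\<lambda>q. ?i q * real q)"
      by (rule integrable_pmf_bounded[where B="real m"]) (auto split: split_indicator)
    have "2 * \<kappa> * measure_pmf.expectation \<pi> (\<lambda>q. ?i q * real q) =
      measure_pmf.expectation \<pi> (\<lambda>q. 2 * \<kappa> * (?i q * real q))"
      by simp
    also have "\<dots> \<le>
      measure_pmf.expectation \<pi> (\<lambda>q. ?i q * (2 * real q) * service_surplus q + 2 * (\<kappa> + M) * \<bar>q0\<bar>)"
    proof (rule expectation_pmf_mono)
      fix q
      have "\<kappa> * real q \<le> real q * service_surplus q + (\<kappa> + M) * \<bar>q0\<bar>"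
      proof (cases "q0 \<le> real q")
        case True
        have "\<kappa> * real q \<le> service_surplus q * real q"
          using surplus[OF True] by (intro mult_right_mono) auto
        moreover have "0 \<le> (\<kappa> + M) * \<bar>q0\<bar>" using \<kappa> M_nonneg by simp
        ultimately show ?thesis by (simp add: algebra_simps)
      next
        case False
        have "real q * (\<kappa> - service_surplus q) \<le> \<bar>q0\<bar> * (\<kappa> + M)"
        proof -
          have "real q * (\<kappa> - service_surplus q) \<le> real q * (\<kappa> + M)"
            using service_surplus_bound[of q] by (intro mult_left_mono) auto
          also have "\<dots> \<le> \<bar>q0\<bar> * (\<kappa> + M)"
            using False \<kappa> M_nonneg by (intro mult_right_mono) auto
          finally show ?thesis .
        qed
        then show ?thesis by (simp add: algebra_simps)
      qed
      then show "2 * \<kappa> * (?i q * real q) \<le> ?i q * (2 * real q) * service_surplus q + 2 * (\<kappa> + M) * \<bar>q0\<bar>"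
        using \<kappa> M_nonneg by (cases "q < m") (simp_all add: algebra_simps)
    qed (use i1 i2 in auto)
    also have "\<dots> = measure_pmf.expectation \<pi> (\<lambda>q. ?i q * (2 * real q) * service_surplus q) +
        2 * (\<kappa> + M) * \<bar>q0\<bar>"
      using i1 by simp
    finally have "\<kappa> * measure_pmf.expectation \<pi> (\<lambda>q. ?i q * real q) \<le> 3 * M\<^sup>2 / 2 + (\<kappa> + M) * \<bar>q0\<bar>"
      using 1 by argo
    then show ?thesis using \<kappa> by (simp add: C_def field_simps)
  qed
  have "(\<integral>\<^sup>+q. ennreal (real q) \<partial>measure_pmf \<pi>) =
    (\<integral>\<^sup>+q. (SUP m. ennreal (indicator {..<real m} (real q) * real q)) \<partial>measure_pmf \<pi>)"
  proof (intro nn_integral_cong antisym)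
    fix q
    show "ennreal (real q) \<le> (SUP m. ennreal (indicator {..<real m} (real q) * real q))"
      by (rule SUP_upper2[of "Suc q"]) auto
  qed (auto intro!: SUP_least split: split_indicator)
  also have "\<dots> = (SUP m. \<integral>\<^sup>+q. ennreal (indicator {..<real m} (real q) * real q) \<partial>measure_pmf \<pi>)"
    by (rule nn_integral_monotone_convergence_SUP)
       (auto simp: incseq_def le_fun_def split: split_indicator)
  also have "\<dots> \<le> ennreal C"
  proof (rule SUP_least)
    fix m :: nat
    have "integrable (measure_pmf \<pi>) (\<lambda>q. indicator {..<real m} (real q) * real q)"
      by (rule integrable_pmf_bounded[where B="real m"]) (auto split: split_indicator)
    then show "(\<integral>\<^sup>+q. ennreal (indicator {..<real m} (real q) * real q) \<partial>measure_pmf \<pi>) \<le> ennreal C"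
      by (subst nn_integral_eq_integral) (auto intro!: ennreal_leI bound)
  qed
  finally show ?thesis
    by (intro integrableI_bounded) (auto simp: top_unique less_top[symmetric])
qed

text \<open>
  If arrivals and services balance below \<open>N\<close>, the square of \<open>max 0 (N - q)\<close> has no first-order drift
  from the net input. Each unit of unused service decreases it to first order by at least
  \<open>2 * (N - M)\<close>, and only the second-order term, at most \<open>M^2\<close>, can compensate for this.
\<close>
lemma expected_unused_le:
  assumes N: "M < N" and surplus: "\<And>q. real q < N \<Longrightarrow> service_surplus q = 0"
  shows "measure_pmf.expectation slot unused \<le> M\<^sup>2 / (2 * (N - M))"
proof -
  define z where "z = (\<lambda>x::real. max 0 (N - x))"
  have z: "\<bar>z (real q)\<bar> \<le> N" for q
    using N M_nonneg by (auto simp: z_def)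
  have zq: "0 \<le> z (queue \<omega>)" "z (queue \<omega>) \<le> N" "0 \<le> z (queue \<omega> + net \<omega> + unused \<omega>)" "z (queue \<omega> + net \<omega> + unused \<omega>) \<le> N"
    if "\<omega> \<in> set_pmf slot" for \<omega>
    using slot_bounds[OF that] N M_nonneg by (auto simp: z_def)
  have i: "integrable (measure_pmf \<pi>) (\<lambda>q. (z (real q))\<^sup>2)"
    using z by (intro integrable_pmf_bounded[where B="N\<^sup>2"]) (use N M_nonneg in \<open>auto simp: power2_le_iff_abs_le\<close>)
  have iu: "integrable (measure_pmf slot) unused"
    using slot_bounds by (intro integrable_pmf_bounded[where B=M]) auto
  have inet: "integrable (measure_pmf slot) (\<lambda>\<omega>. z (queue \<omega>) * net \<omega>)"
  proof (rule integrable_pmf_bounded)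
    fix \<omega> assume \<omega>: "\<omega> \<in> set_pmf slot"
    show "\<bar>z (queue \<omega>) * net \<omega>\<bar> \<le> N * M"
      using slot_bounds[OF \<omega>] zq[OF \<omega>] N M_nonneg unfolding abs_mult by (intro mult_mono) auto
  qed
  have "measure_pmf.expectation slot (\<lambda>\<omega>. z (queue \<omega>) * net \<omega>) = 0"
  proof (subst expectation_net(1)[of z, OF z], simp, intro integral_eq_zero_AE AE_I2)
    show "z (real q) * service_surplus q = 0" for q
      using surplus[of q] by (cases "real q < N") (auto simp: z_def)
  qed
  moreover have "measure_pmf.expectation slot (\<lambda>\<omega>. (z (queue \<omega> + net \<omega> + unused \<omega>))\<^sup>2 - (z (queue \<omega>))\<^sup>2) = 0"
    using i by (simp add: expectation_slot_next[where g="\<lambda>x. (z x)\<^sup>2"] expectation_slot_queue[where g="\<lambda>x. (z x)\<^sup>2"])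
  moreover have "measure_pmf.expectation slot (\<lambda>\<omega>. (z (queue \<omega> + net \<omega> + unused \<omega>))\<^sup>2 - (z (queue \<omega>))\<^sup>2) \<le>
    measure_pmf.expectation slot (\<lambda>\<omega>. M\<^sup>2 - 2 * (z (queue \<omega>) * net \<omega>) - 2 * (N - M) * unused \<omega>)"
  proof (rule expectation_pmf_mono)
    show "integrable (measure_pmf slot) (\<lambda>\<omega>. (z (queue \<omega> + net \<omega> + unused \<omega>))\<^sup>2 - (z (queue \<omega>))\<^sup>2)"
      using i by (simp add: expectation_slot_next[where g="\<lambda>x. (z x)\<^sup>2"] expectation_slot_queue[where g="\<lambda>x. (z x)\<^sup>2"])
    fix \<omega> assume \<omega>: "\<omega> \<in> set_pmf slot"
    note b = slot_bounds[OF \<omega>]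
    define d where "d = net \<omega> + unused \<omega>"
    have d: "d\<^sup>2 \<le> M\<^sup>2" using b by (simp add: d_def abs_le_square_iff[symmetric])
    have "(z (queue \<omega> + net \<omega> + unused \<omega>))\<^sup>2 \<le> (z (queue \<omega>) - d)\<^sup>2"
      unfolding abs_le_square_iff[symmetric] by (auto simp: z_def d_def)
    moreover have "(N - M) * unused \<omega> \<le> z (queue \<omega>) * unused \<omega>"
      using b by (cases "unused \<omega> = 0") (auto simp: z_def intro!: mult_right_mono)
    ultimately show "(z (queue \<omega> + net \<omega> + unused \<omega>))\<^sup>2 - (z (queue \<omega>))\<^sup>2 \<le>
      M\<^sup>2 - 2 * (z (queue \<omega>) * net \<omega>) - 2 * (N - M) * unused \<omega>"
      using d by (simp add: power2_diff d_def algebra_simps)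
  qed (use iu inet in auto)
  moreover have "measure_pmf.expectation slot (\<lambda>\<omega>. M\<^sup>2 - 2 * (z (queue \<omega>) * net \<omega>) - 2 * (N - M) * unused \<omega>) =
    M\<^sup>2 - 2 * measure_pmf.expectation slot (\<lambda>\<omega>. z (queue \<omega>) * net \<omega>) -
      2 * (N - M) * measure_pmf.expectation slot unused"
    using iu inet by simp
  ultimately have "2 * (N - M) * measure_pmf.expectation slot unused \<le> M\<^sup>2"
    by simp
  then show ?thesis using N by (simp add: pos_le_divide_eq mult.commute)
qed

end

section \<open>The generator of the scaled queue\<close>

lemma antiderivative_half_line:
  fixes g :: "real \<Rightarrow> real"
  assumes "continuous_on {0..} g" "0 \<le> x"
  shows "((\<lambda>x. integral {0..x} g) has_real_derivative g x) (at x within {0..})"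
proof -
  have "((\<lambda>x. integral {0..x} g) has_real_derivative g x) (at x within {0..x + 1})"
    using assms by (intro integral_has_real_derivative continuous_on_subset[OF assms(1)]) auto
  moreover have "at x within {0..x + 1} = at x within {0..}"
    by (rule at_within_nhd[of _ "{..<x + 1}"]) auto
  ultimately show ?thesis by simp
qed

text \<open>
  The remainder is bounded by the oscillation of \<open>v\<close> rather than by a third derivative: the solutions
  of the Stein equations have only two derivatives.
\<close>
lemma second_order_expansion:
  fixes f w v :: "real \<Rightarrow> real"
  assumes f: "\<And>t. 0 \<le> t \<Longrightarrow> (f has_real_derivative w t) (at t within {0..})"
    and w: "\<And>t. 0 \<le> t \<Longrightarrow> (w has_real_derivative v t) (at t within {0..})"
    and v: "\<And>s t. 0 \<le> s \<Longrightarrow> 0 \<le> t \<Longrightarrow> \<bar>s - t\<bar> \<le> \<rho> \<Longrightarrow> \<bar>v s - v t\<bar> \<le> \<kappa>"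
    and xy: "0 \<le> x" "0 \<le> y" "\<bar>y - x\<bar> \<le> \<rho>"
  shows "\<bar>f y - f x - w x * (y - x) - v x * (y - x)\<^sup>2 / 2\<bar> \<le> \<kappa> * (y - x)\<^sup>2"
proof -
  define I where "I = closed_segment x y"
  have I: "I \<subseteq> {0..}" "x \<in> I" "y \<in> I" "convex I"
    using xy by (auto simp: I_def closed_segment_eq_real_ivl split: if_splits)
  have dist: "\<bar>t - x\<bar> \<le> \<bar>y - x\<bar>" if "t \<in> I" for t
    using that by (auto simp: I_def closed_segment_eq_real_ivl split: if_splits)
  have \<kappa>: "0 \<le> \<kappa>" using v[of x x] xy by simp
  have w_bound: "\<bar>w t - w x - v x * (t - x)\<bar> \<le> \<kappa> * \<bar>y - x\<bar>" if t: "t \<in> I" for t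
  proof -
    have "norm ((w t - v x * t) - (w x - v x * x)) \<le> \<kappa> * norm (t - x)"
    proof (rule field_differentiable_bound[OF I(4), where f'="\<lambda>t. v t - v x"])
      fix z assume z: "z \<in> I"
      then have "0 \<le> z" using I by auto
      then show "((\<lambda>t. w t - v x * t) has_field_derivative v z - v x) (at z within I)"
        by (auto intro!: derivative_eq_intros DERIV_subset[OF w I(1)])
      show "norm (v z - v x) \<le> \<kappa>"
        using v[of z x] \<open>0 \<le> z\<close> xy dist[OF z] by auto
    qed (use t I in auto)
    also have "\<dots> \<le> \<kappa> * \<bar>y - x\<bar>" using dist[OF t] \<kappa> by (auto intro: mult_left_mono)
    finally show ?thesis by (simp add: algebra_simps)
  qed
  have "norm ((f y - w x * y - v x * (y - x)\<^sup>2 / 2) - (f x - w x * x - v x * (x - x)\<^sup>2 / 2))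
    \<le> (\<kappa> * \<bar>y - x\<bar>) * norm (y - x)"
  proof (rule field_differentiable_bound[OF I(4), where f'="\<lambda>t. w t - w x - v x * (t - x)"])
    fix z assume z: "z \<in> I"
    then have "0 \<le> z" using I by auto
    then show "((\<lambda>t. f t - w x * t - v x * (t - x)\<^sup>2 / 2) has_field_derivative
        w z - w x - v x * (z - x)) (at z within I)"
      by (auto intro!: derivative_eq_intros DERIV_subset[OF f I(1)])
    show "norm (w z - w x - v x * (z - x)) \<le> \<kappa> * \<bar>y - x\<bar>"
      using w_bound[OF z] by simp
  qed (use I in auto)
  then show ?thesis by (simp add: power2_eq_square algebra_simps)
qed

context stationary_queue
begin

text \<open>
  The mean of \<open>f (r * q)\<close> is unchanged by a slot, where \<open>f\<close> is an antiderivative of \<open>w\<close>; the mean exists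
  because \<open>f\<close> grows at most linearly. In the second-order expansion of the change, the unused service
  appears with the factor \<open>w (r * q)\<close>, which is of order \<open>r\<close> at the queue lengths where service can be
  wasted, because \<open>w 0 = 0\<close>. After division by \<open>r^2\<close> its contribution is a multiple of the mean unused
  service.
\<close>
lemma generator_estimate:
  fixes w v :: "real \<Rightarrow> real"
  assumes int: "integrable (measure_pmf \<pi>) real" and r: "0 < r"
    and w: "\<And>x. 0 \<le> x \<Longrightarrow> (w has_real_derivative v x) (at x within {0..})" "w 0 = 0"
    and W: "\<And>x. 0 \<le> x \<Longrightarrow> \<bar>w x\<bar> \<le> W" and L: "\<And>x. 0 \<le> x \<Longrightarrow> \<bar>v x\<bar> \<le> L"
    and \<kappa>: "\<And>x y. 0 \<le> x \<Longrightarrow> 0 \<le> y \<Longrightarrow> \<bar>x - y\<bar> \<le> r * M \<Longrightarrow> \<bar>v x - v y\<bar> \<le> \<kappa>"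
  shows "\<bar>measure_pmf.expectation \<pi> (\<lambda>q. w (r * real q) * service_surplus q) / r -
      measure_pmf.expectation \<pi> (\<lambda>q. v (r * real q) * net_square q) / 2\<bar> \<le>
    2 * L * M * measure_pmf.expectation \<pi> service_surplus + \<kappa> * M\<^sup>2"
proof -
  define f where "f = (\<lambda>x. integral {0..x} w)"
  have f: "(f has_real_derivative w x) (at x within {0..})" if "0 \<le> x" for x
    unfolding f_def using w(1) that
    by (intro antiderivative_half_line) (auto simp: continuous_on_eq_continuous_within intro: DERIV_continuous)
  have W0: "0 \<le> W" and L0: "0 \<le> L" using W[of 0] L[of 0] by auto
  have lip: "\<bar>w x\<bar> \<le> L * x" and f_bound: "\<bar>f x\<bar> \<le> W * x" if "0 \<le> x" for x
    using field_differentiable_bound[of "{0..}" w v L x 0] field_differentiable_bound[of "{0..}" f w W x 0]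
      w f W L that by (auto simp: f_def)
  have \<kappa>0: "0 \<le> \<kappa>" using \<kappa>[of 0 0] r M_nonneg by simp
  have if1: "integrable (measure_pmf \<pi>) (\<lambda>q. f (r * real q))"
  proof (rule Bochner_Integration.integrable_bound)
    show "integrable (measure_pmf \<pi>) (\<lambda>q. W * (r * real q))" using int by simp
    show "AE q in measure_pmf \<pi>. norm (f (r * real q)) \<le> norm (W * (r * real q))"
      using f_bound[of "r * real _"] r W0 by (intro AE_I2) (auto intro: order_trans)
  qed simp
  have iw: "integrable (measure_pmf slot) (\<lambda>\<omega>. w (r * queue \<omega>) * net \<omega>)"
    and iv: "integrable (measure_pmf slot) (\<lambda>\<omega>. v (r * queue \<omega>) * (net \<omega>)\<^sup>2)"
    and iu: "integrable (measure_pmf slot) unused"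
  proof -
    show "integrable (measure_pmf slot) (\<lambda>\<omega>. w (r * queue \<omega>) * net \<omega>)"
      by (rule integrable_pmf_bounded[where B="W * M"])
         (use slot_bounds W r W0 in \<open>auto simp: abs_mult intro!: mult_mono\<close>)
    show "integrable (measure_pmf slot) (\<lambda>\<omega>. v (r * queue \<omega>) * (net \<omega>)\<^sup>2)"
      by (rule integrable_pmf_bounded[where B="L * M\<^sup>2"])
         (use slot_bounds L r L0 M_nonneg in \<open>auto simp: abs_mult power2_le_iff_abs_le intro!: mult_mono\<close>)
    show "integrable (measure_pmf slot) unused"
      using slot_bounds by (intro integrable_pmf_bounded[where B=M]) auto
  qed
  let ?D = "\<lambda>\<omega>. f (r * (queue \<omega> + net \<omega> + unused \<omega>)) - f (r * queue \<omega>)"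
  let ?T = "\<lambda>\<omega>. r * (w (r * queue \<omega>) * net \<omega>) + r\<^sup>2 / 2 * (v (r * queue \<omega>) * (net \<omega>)\<^sup>2)"
  have iD: "integrable (measure_pmf slot) ?D"
    using if1 by (simp add: expectation_slot_next[where g="\<lambda>x. f (r * x)"] expectation_slot_queue[where g="\<lambda>x. f (r * x)"])
  have D0: "measure_pmf.expectation slot ?D = 0"
    using if1 by (simp add: expectation_slot_next[where g="\<lambda>x. f (r * x)"] expectation_slot_queue[where g="\<lambda>x. f (r * x)"])
  have pointwise: "\<bar>?T \<omega> - ?D \<omega>\<bar> \<le> r\<^sup>2 * (2 * L * M * unused \<omega> + \<kappa> * M\<^sup>2)"
    if \<omega>: "\<omega> \<in> set_pmf slot" for \<omega>
  proof -
    note b = slot_bounds[OF \<omega>]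
    define X where "X = r * queue \<omega>"
    define d where "d = net \<omega> + unused \<omega>"
    define u where "u = unused \<omega>"
    have "X + r * d = r * (queue \<omega> + net \<omega> + unused \<omega>)" by (simp add: X_def d_def algebra_simps)
    then have X: "0 \<le> X" "0 \<le> X + r * d" using b r by (auto simp: X_def)
    have d: "\<bar>d\<bar> \<le> M" "\<bar>net \<omega>\<bar> \<le> M" using b by (auto simp: d_def)
    have u: "0 \<le> u" using b by (simp add: u_def)
    have "\<bar>r * d\<bar> \<le> r * M" using d r by (simp add: abs_mult)
    then have "\<bar>f (X + r * d) - f X - w X * (r * d) - v X * (r * d)\<^sup>2 / 2\<bar> \<le> \<kappa> * (r * d)\<^sup>2"
      using second_order_expansion[of f w v "r * M" \<kappa> X "X + r * d", OF f w(1) \<kappa>] X by simp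
    also have "\<dots> \<le> \<kappa> * (r\<^sup>2 * M\<^sup>2)"
      unfolding power_mult_distrib using d \<kappa>0 M_nonneg
      by (intro mult_left_mono) (auto simp: power2_le_iff_abs_le)
    finally have 1: "\<bar>f (X + r * d) - f X - w X * (r * d) - v X * (r * d)\<^sup>2 / 2\<bar> \<le> \<kappa> * (r\<^sup>2 * M\<^sup>2)" .
    have 2: "\<bar>w X * (r * u)\<bar> \<le> r\<^sup>2 * (L * M * u)"
    proof (cases "u = 0")
      case False
      then have "X \<le> r * M" using b r by (simp add: X_def u_def)
      then have "\<bar>w X\<bar> \<le> L * (r * M)" using lip[OF X(1)] L0 by (meson mult_left_mono order_trans)
      then have "\<bar>w X\<bar> * (r * u) \<le> L * (r * M) * (r * u)" using r u by (intro mult_right_mono) auto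
      then show ?thesis using r u by (simp add: abs_mult power2_eq_square algebra_simps)
    qed simp
    have 3: "\<bar>v X * (r * d)\<^sup>2 / 2 - v X * (r * net \<omega>)\<^sup>2 / 2\<bar> \<le> r\<^sup>2 * (L * M * u)"
    proof -
      have "(r * d)\<^sup>2 - (r * net \<omega>)\<^sup>2 = r\<^sup>2 * (u * (d + net \<omega>))"
        by (simp add: d_def u_def power2_eq_square algebra_simps)
      then have "\<bar>v X * (r * d)\<^sup>2 / 2 - v X * (r * net \<omega>)\<^sup>2 / 2\<bar> = \<bar>v X\<bar> * (r\<^sup>2 * (u * \<bar>d + net \<omega>\<bar>)) / 2"
        using u by (simp add: abs_mult flip: diff_divide_distrib right_diff_distrib)
      also have "\<dots> \<le> L * (r\<^sup>2 * (u * (2 * M))) / 2"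
        using L[OF X(1)] d u L0 by (intro divide_right_mono mult_mono) auto
      finally show ?thesis by (simp add: algebra_simps)
    qed
    have eq: "?T \<omega> - ?D \<omega> = - (f (X + r * d) - f X - w X * (r * d) - v X * (r * d)\<^sup>2 / 2)
      - w X * (r * u) - (v X * (r * d)\<^sup>2 / 2 - v X * (r * net \<omega>)\<^sup>2 / 2)"
      by (simp add: X_def d_def u_def power_mult_distrib algebra_simps)
    show ?thesis unfolding eq using 1 2 3 by (simp add: u_def[symmetric] algebra_simps)
  qed
  have "\<bar>measure_pmf.expectation slot (\<lambda>\<omega>. ?T \<omega> - ?D \<omega>)\<bar> \<le>
      measure_pmf.expectation slot (\<lambda>\<omega>. r\<^sup>2 * (2 * L * M * unused \<omega> + \<kappa> * M\<^sup>2))"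
    by (rule expectation_pmf_abs_le[OF _ pointwise]) (use iu in auto)
  also have "\<dots> = r\<^sup>2 * (2 * L * M * measure_pmf.expectation \<pi> service_surplus + \<kappa> * M\<^sup>2)"
    using iu expected_unused[OF int] by simp
  finally have "\<bar>measure_pmf.expectation slot ?T\<bar> \<le>
      r\<^sup>2 * (2 * L * M * measure_pmf.expectation \<pi> service_surplus + \<kappa> * M\<^sup>2)"
    using iw iv iD D0 by simp
  moreover have "measure_pmf.expectation slot ?T =
      - r * measure_pmf.expectation \<pi> (\<lambda>q. w (r * real q) * service_surplus q) +
      r\<^sup>2 / 2 * measure_pmf.expectation \<pi> (\<lambda>q. v (r * real q) * net_square q)"
    using iw iv W L r expectation_net(1)[of "\<lambda>x. w (r * x)" W] expectation_net(2)[of "\<lambda>x. v (r * x)" L] by simp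
  moreover have "- r * x + r\<^sup>2 / 2 * y = - (r\<^sup>2) * (x / r - y / 2)" for x y
    using r by (simp add: power2_eq_square field_simps)
  ultimately show ?thesis using r by (simp add: abs_mult)
qed

end

section \<open>Gibbs laws and their Stein equation\<close>

text \<open>
  Both \<open>C * p + P\<close> and \<open>C * p - P\<close> are non-increasing and vanish at infinity, hence are nonnegative.
\<close>
lemma bounded_by_vanishing_dominator:
  fixes P p :: "real \<Rightarrow> real"
  assumes x: "a < x" and C: "0 \<le> C"
    and P: "\<And>t. a < t \<Longrightarrow> (P has_real_derivative P' t) (at t)" "(P \<longlongrightarrow> 0) at_top"
    and p: "\<And>t. a < t \<Longrightarrow> (p has_real_derivative p' t) (at t)" "(p \<longlongrightarrow> 0) at_top"
    and dom: "\<And>t. a < t \<Longrightarrow> \<bar>P' t\<bar> \<le> - C * p' t"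
  shows "\<bar>P x\<bar> \<le> C * p x"
proof -
  have "0 \<le> C * p x + s * P x" if s: "\<bar>s\<bar> = 1" for s
  proof (rule tendsto_upperbound)
    show "((\<lambda>y. C * p y + s * P y) \<longlongrightarrow> 0) at_top"
      using tendsto_add[OF tendsto_mult_right_zero[OF p(2)] tendsto_mult_right_zero[OF P(2)], of C s] by simp
    show "\<forall>\<^sub>F y in at_top. C * p y + s * P y \<le> C * p x + s * P x"
      using eventually_ge_at_top[of x]
    proof eventually_elim
      case (elim y)
      show ?case
      proof (rule DERIV_nonpos_imp_nonincreasing[OF elim])
        fix t assume t: "x \<le> t" "t \<le> y"
        have "s * P' t \<le> \<bar>P' t\<bar>" using s by (auto simp: abs_if split: if_splits)
        then have "C * p' t + s * P' t \<le> 0" using dom[of t] t x by simp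
        moreover have "((\<lambda>y. C * p y + s * P y) has_real_derivative C * p' t + s * P' t) (at t)"
          using t x by (auto intro!: derivative_eq_intros P p)
        ultimately show "\<exists>y. ((\<lambda>y. C * p y + s * P y) has_real_derivative y) (at t) \<and> y \<le> 0" by blast
      qed
    qed
  qed simp
  from this[of 1] this[of "-1"] show ?thesis by simp
qed

text \<open>
  The lower bound far out makes the Gibbs weight integrable and, more importantly, makes its tail
  integrals comparable to the weight itself.
\<close>
locale gibbs_potential =
  fixes g :: "real \<Rightarrow> real" and B \<beta> K :: real
  assumes g_continuous: "continuous_on {0..} g"
    and g_bound: "\<And>x. 0 \<le> x \<Longrightarrow> \<bar>g x\<bar> \<le> B"
    and \<beta>: "0 < \<beta>" "0 \<le> K" "\<And>x. K < x \<Longrightarrow> \<beta> \<le> g x"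
begin

definition weight :: "real \<Rightarrow> real" where "weight x = exp (- integral {0..x} g)"

lemma weight_pos: "0 < weight x" by (simp add: weight_def)

lemma weight_deriv:
  "0 \<le> x \<Longrightarrow> (weight has_real_derivative - g x * weight x) (at x within {0..})"
  unfolding weight_def[abs_def]
  by (auto intro!: derivative_eq_intros antiderivative_half_line g_continuous)

lemma at_within_half_line: "0 < x \<Longrightarrow> at x within {0..} = at (x::real)"
  by (rule at_within_interior) auto

lemma weight_continuous: "continuous_on {0..} weight"
  using weight_deriv by (auto simp: continuous_on_eq_continuous_within intro: DERIV_continuous)

lemma weight_decay:
  assumes "K < x" "x \<le> y"
  shows "weight y \<le> weight x * exp (- \<beta> * (y - x))"
proof -
  have "weight y * exp (\<beta> * y) \<le> weight x * exp (\<beta> * x)"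
  proof (rule DERIV_nonpos_imp_nonincreasing[OF assms(2)])
    fix t assume t: "x \<le> t" "t \<le> y"
    then have "0 < t" "K < t" using assms \<beta> by auto
    have "((\<lambda>t. weight t * exp (\<beta> * t)) has_real_derivative (\<beta> - g t) * (weight t * exp (\<beta> * t))) (at t)"
      using weight_deriv[of t] \<open>0 < t\<close>
      by (auto intro!: derivative_eq_intros simp: at_within_half_line algebra_simps)
    moreover have "(\<beta> - g t) * (weight t * exp (\<beta> * t)) \<le> 0"
      using \<beta>(3)[OF \<open>K < t\<close>] weight_pos[of t] by (intro mult_nonpos_nonneg) auto
    ultimately show "\<exists>y. ((\<lambda>t. weight t * exp (\<beta> * t)) has_real_derivative y) (at t) \<and> y \<le> 0" by blast
  qed
  then have "weight y \<le> weight x * exp (\<beta> * x) * exp (- (\<beta> * y))"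
    by (simp add: exp_minus field_simps)
  also have "\<dots> = weight x * exp (- \<beta> * (y - x))"
    by (simp add: algebra_simps flip: exp_add)
  finally show ?thesis .
qed

lemma weight_tendsto: "(weight \<longlongrightarrow> 0) at_top"
proof (rule tendsto_sandwich)
  show "\<forall>\<^sub>F y in at_top. 0 \<le> weight y" by (simp add: weight_def)
  show "\<forall>\<^sub>F y in at_top. weight y \<le> weight (K + 1) * exp (- \<beta> * (y - (K + 1)))"
    using eventually_ge_at_top[of "K + 1"] by eventually_elim (rule weight_decay, auto)
  have "((\<lambda>y. exp (- \<beta> * y)) \<longlongrightarrow> 0) at_top"
    using \<beta>(1) by real_asymp
  from tendsto_mult_right_zero[OF this, of "weight (K + 1) * exp (\<beta> * (K + 1))"]
  show "((\<lambda>y. weight (K + 1) * exp (- \<beta> * (y - (K + 1)))) \<longlongrightarrow> 0) at_top"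
    by (simp add: algebra_simps flip: exp_add)
qed simp

lemma set_integrable_weight:
  fixes f :: "real \<Rightarrow> real"
  assumes f: "continuous_on {0..} f" and H: "\<And>x. 0 \<le> x \<Longrightarrow> \<bar>f x\<bar> \<le> H"
  shows "set_integrable lborel {0..} (\<lambda>x. f x * weight x)"
proof -
  have cont: "continuous_on {0..} (\<lambda>x. f x * weight x)"
    using f weight_continuous by (intro continuous_intros)
  have 1: "set_integrable lborel {0..K + 1} (\<lambda>x. f x * weight x)"
    by (intro borel_integrable_atLeastAtMost' continuous_on_subset[OF cont]) auto
  have 2: "set_integrable lborel {K + 1..} (\<lambda>x. f x * weight x)"
  proof (rule set_integrable_bound)
    have "(\<lambda>x. exp (- \<beta> * x)) absolutely_integrable_on {K + 1..}"
      using integrable_on_exp_minus_to_infinity[OF \<beta>(1)] by (intro nonnegative_absolutely_integrable_1) auto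
    then have "set_integrable lborel {K + 1..} (\<lambda>x. exp (- \<beta> * x))"
      unfolding set_integrable_def by (subst (asm) integrable_completion) auto
    then show "set_integrable lborel {K + 1..} (\<lambda>x. (H * weight (K + 1) * exp (\<beta> * (K + 1))) * exp (- \<beta> * x))"
      by (intro set_integrable_mult_right) auto
    have "(\<lambda>x. indicator {K + 1..} x *\<^sub>R (f x * weight x)) \<in> borel_measurable borel"
      using \<beta> by (intro borel_measurable_continuous_on_indicator continuous_on_subset[OF cont]) auto
    then show "set_borel_measurable lborel {K + 1..} (\<lambda>x. f x * weight x)"
      unfolding set_borel_measurable_def by simp
    show "AE x in lborel. x \<in> {K + 1..} \<longrightarrow> norm (f x * weight x) \<le>
      norm ((H * weight (K + 1) * exp (\<beta> * (K + 1))) * exp (- \<beta> * x))"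
    proof (intro AE_I2 impI)
      fix x assume x: "x \<in> {K + 1..}"
      have H0: "0 \<le> H" using H[of 0] by simp
      have "\<bar>f x\<bar> * weight x \<le> H * (weight (K + 1) * exp (- \<beta> * (x - (K + 1))))"
        using x H[of x] \<beta> weight_decay[of "K + 1" x] weight_pos[of x] H0 by (intro mult_mono) auto
      also have "\<dots> = (H * weight (K + 1) * exp (\<beta> * (K + 1))) * exp (- \<beta> * x)"
        by (simp add: algebra_simps flip: exp_add)
      finally show "norm (f x * weight x) \<le> norm ((H * weight (K + 1) * exp (\<beta> * (K + 1))) * exp (- \<beta> * x))"
        using H0 weight_pos[of x] weight_pos[of "K + 1"] by (simp add: abs_mult)
    qed
  qed
  have "{0..} = {0..K + 1} \<union> {K + 1..}" using \<beta> by auto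
  then show ?thesis using set_integrable_Un[OF 1 2] by simp
qed

definition mass :: real where "mass = (LBINT x:{0..}. weight x)"

lemma mass_pos: "0 < mass"
proof -
  have i: "set_integrable lborel {0..} weight" using set_integrable_weight[of "\<lambda>_. 1" 1] by simp
  have i2: "set_integrable lborel {0..1} weight"
    by (rule set_integrable_subset[OF i]) auto
  obtain z where z: "z \<in> {0..1}" "\<And>x. x \<in> {0..1} \<Longrightarrow> weight z \<le> weight x"
    using continuous_attains_inf[of "{0..1::real}" weight] continuous_on_subset[OF weight_continuous, of "{0..1}"] by auto
  have "0 < weight z" by (rule weight_pos)
  also have "\<dots> = (LBINT x:{0..1::real}. weight z)"
    by (subst set_integral_const) auto
  also have "\<dots> \<le> (LBINT x:{0..1}. weight x)"
    using i2 z(2) by (intro set_integral_mono) (auto intro: borel_integrable_atLeastAtMost')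
  also have "\<dots> \<le> mass"
    using i i2 less_imp_le[OF weight_pos] unfolding mass_def set_lebesgue_integral_def set_integrable_def
    by (intro integral_mono) (auto split: split_indicator)
  finally show ?thesis .
qed

lemma gibbs_density_eq: "gibbs_density g x = indicator {0..} x * weight x / mass"
proof -
  have *: "(LBINT t:{0..x}. g t) = integral {0..x} g" if "0 \<le> x" for x
    using that by (intro set_borel_integral_eq_integral borel_integrable_atLeastAtMost'
        continuous_on_subset[OF g_continuous]) auto
  then have "(LBINT u:{0..}. exp (- (LBINT t:{0..u}. g t))) = mass"
    unfolding mass_def weight_def by (intro set_lebesgue_integral_cong) auto
  then show ?thesis
    using * by (auto simp: gibbs_density_def weight_def split: split_indicator)
qed

lemma gibbs_density_nonneg: "0 \<le> gibbs_density g x"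
  using mass_pos weight_pos[of x] by (auto simp: gibbs_density_eq split: split_indicator)

lemma gibbs_density_measurable [measurable]: "gibbs_density g \<in> borel_measurable borel"
proof -
  have "(\<lambda>x. indicator {0..} x *\<^sub>R weight x) \<in> borel_measurable borel"
    using weight_continuous by (intro borel_measurable_continuous_on_indicator) auto
  then show ?thesis by (simp add: gibbs_density_eq[abs_def])
qed

lemma integral_gibbs:
  fixes h :: "real \<Rightarrow> real"
  assumes [measurable]: "h \<in> borel_measurable borel"
  shows "integral\<^sup>L (gibbs_law g) h = (LBINT x:{0..}. h x * weight x) / mass"
proof -
  have "integral\<^sup>L (gibbs_law g) h = (\<integral>x. gibbs_density g x *\<^sub>R h x \<partial>lborel)"
    unfolding gibbs_law_def by (rule integral_density) (auto simp: gibbs_density_nonneg)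
  also have "\<dots> = (\<integral>x. (indicator {0..} x *\<^sub>R (h x * weight x)) / mass \<partial>lborel)"
    by (intro Bochner_Integration.integral_cong) (auto simp: gibbs_density_eq)
  finally show ?thesis by (simp add: set_lebesgue_integral_def)
qed

lemma real_distribution_gibbs: "real_distribution (gibbs_law g)"
proof -
  have i: "integrable lborel (gibbs_density g)"
    using set_integrable_weight[of "\<lambda>_. 1" 1] unfolding gibbs_density_eq[abs_def] set_integrable_def by simp
  have "emeasure (gibbs_law g) UNIV = (\<integral>\<^sup>+x. ennreal (gibbs_density g x) \<partial>lborel)"
    unfolding gibbs_law_def by (subst emeasure_density) auto
  also have "\<dots> = ennreal (\<integral>x. gibbs_density g x \<partial>lborel)"
    using i gibbs_density_nonneg by (intro nn_integral_eq_integral) auto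
  also have "(\<integral>x. gibbs_density g x \<partial>lborel) = 1"
    using mass_pos unfolding gibbs_density_eq[abs_def]
    by (simp add: mass_def set_lebesgue_integral_def)
  finally have "prob_space (gibbs_law g)" by (intro prob_spaceI) (simp add: gibbs_law_def)
  then show ?thesis
    by (auto simp: real_distribution_def real_distribution_axioms_def gibbs_law_def)
qed

text \<open>
  Variation of constants gives \<open>w = P / weight\<close>, where \<open>P\<close> is the integral of \<open>(h - m) * weight\<close> from
  zero and \<open>m\<close> is the mean of \<open>h\<close>. The choice of \<open>m\<close> makes \<open>P\<close> vanish at infinity. Beyond \<open>K\<close> the weight
  decreases at least as fast as \<open>\<beta> * weight\<close>, so that \<open>P\<close> is dominated there by a multiple of the
  weight; on \<open>[0, K]\<close> continuity gives a bound.
\<close>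
lemma stein_equation:
  fixes h :: "real \<Rightarrow> real"
  assumes h_cont: "continuous_on UNIV h" and H: "\<And>x. \<bar>h x\<bar> \<le> H"
  obtains w W where "w 0 = 0" "\<And>x. 0 \<le> x \<Longrightarrow> \<bar>w x\<bar> \<le> W"
    "\<And>x. 0 \<le> x \<Longrightarrow> (w has_real_derivative h x - integral\<^sup>L (gibbs_law g) h + g x * w x) (at x within {0..})"
proof -
  define m where "m = integral\<^sup>L (gibbs_law g) h"
  have h_cont': "continuous_on S h" for S by (rule continuous_on_subset[OF h_cont]) simp
  have hi: "set_integrable lborel {0..} (\<lambda>x. h x * weight x)"
    by (rule set_integrable_weight[OF h_cont' H])
  have wi: "set_integrable lborel {0..} weight"
    using set_integrable_weight[of "\<lambda>_. 1" 1] by simp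
  have hmi: "set_integrable lborel {0..} (\<lambda>x. (h x - m) * weight x)"
    unfolding left_diff_distrib using hi wi by (intro set_integral_diff set_integrable_mult_right)
  have "(LBINT x:{0..}. h x * weight x) = m * mass"
    using integral_gibbs[of h] h_cont mass_pos by (simp add: m_def borel_measurable_continuous_onI)
  then have total: "(LBINT x:{0..}. (h x - m) * weight x) = 0"
    unfolding left_diff_distrib using hi wi by (subst set_integral_diff) (auto simp: mass_def)
  define P where "P = (\<lambda>x. integral {0..x} (\<lambda>t. (h t - m) * weight t))"
  have P_deriv: "(P has_real_derivative (h x - m) * weight x) (at x within {0..})" if "0 \<le> x" for x
    unfolding P_def using that by (intro antiderivative_half_line continuous_intros h_cont' weight_continuous)
  have P_tendsto: "(P \<longlongrightarrow> 0) at_top"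
  proof -
    have "((\<lambda>y. LBINT x:{0..y}. (h x - m) * weight x) \<longlongrightarrow> 0) at_top"
      using tendsto_set_lebesgue_integral_at_top[OF _ hmi] total by simp
    moreover have "(LBINT x:{0..y}. (h x - m) * weight x) = P y" for y
      unfolding P_def by (intro set_borel_integral_eq_integral set_integrable_subset[OF hmi]) auto
    ultimately show ?thesis by simp
  qed
  define w where "w = (\<lambda>x. P x / weight x)"
  have w0: "w 0 = 0" by (simp add: w_def P_def)
  have w_deriv: "(w has_real_derivative h x - m + g x * w x) (at x within {0..})" if "0 \<le> x" for x
  proof -
    have "(w has_real_derivative ((h x - m) * weight x * weight x - P x * (- g x * weight x)) / (weight x * weight x))
      (at x within {0..})"
      unfolding w_def using weight_pos[of x] that by (intro DERIV_divide P_deriv weight_deriv) auto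
    moreover have "((h x - m) * weight x * weight x - P x * (- g x * weight x)) / (weight x * weight x) =
      h x - m + g x * w x"
      using weight_pos[of x] by (simp add: w_def field_simps)
    ultimately show ?thesis by simp
  qed
  define C where "C = (H + \<bar>m\<bar>) / \<beta>"
  have H0: "0 \<le> H" using H[of 0] by simp
  have C0: "0 \<le> C" using \<beta> H0 by (simp add: C_def)
  \<comment> \<open>\<open>C\<close> is a bound of \<open>\<bar>h - m\<bar>\<close> divided by the lower bound \<open>\<beta>\<close> of \<open>g\<close> beyond \<open>K\<close>.\<close>
  have tail: "\<bar>w x\<bar> \<le> C" if "K < x" for x
  proof -
    have "\<bar>P x\<bar> \<le> C * weight x"
    proof (rule bounded_by_vanishing_dominator[OF that C0])
      fix t assume t: "K < t"
      then have "0 < t" using \<beta> by simp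
      show "(P has_real_derivative (h t - m) * weight t) (at t)"
        "(weight has_real_derivative - g t * weight t) (at t)"
        using P_deriv[of t] weight_deriv[of t] \<open>0 < t\<close> by (auto simp: at_within_half_line)
      have "\<bar>h t - m\<bar> \<le> C * \<beta>" using H[of t] \<beta> by (simp add: C_def)
      also have "\<dots> \<le> C * g t" using \<beta>(3)[OF t] C0 by (intro mult_left_mono)
      finally have "\<bar>h t - m\<bar> * weight t \<le> C * g t * weight t"
        using weight_pos[of t] by (intro mult_right_mono) auto
      then show "\<bar>(h t - m) * weight t\<bar> \<le> - C * (- g t * weight t)"
        using weight_pos[of t] by (simp add: abs_mult)
    qed (rule P_tendsto weight_tendsto)+
    then show ?thesis using weight_pos[of x] by (simp add: w_def abs_mult pos_divide_le_eq)
  qed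
  have "continuous_on {0..} w"
    using w_deriv by (auto simp: continuous_on_eq_continuous_within intro: DERIV_continuous)
  then have "continuous_on {0..K} w" by (rule continuous_on_subset) auto
  then have "bounded (w ` {0..K})" by (intro compact_imp_bounded compact_continuous_image) auto
  then obtain D where D: "\<And>x. x \<in> {0..K} \<Longrightarrow> \<bar>w x\<bar> \<le> D" unfolding bounded_iff by auto (metis atLeastAtMost_iff)
  have "\<bar>w x\<bar> \<le> max C D" if "0 \<le> x" for x
    using tail[of x] D[of x] that by (cases "K < x") (auto simp: le_max_iff_disj)
  then show ?thesis using that[of w "max C D"] w0 w_deriv by (auto simp: m_def)
qed

end

text \<open>
  This makes the first regime an instance of the limit theorem for Gibbs laws.
\<close>
lemma exponential_law_eq_gibbs_law:
  assumes r: "0 < r"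
  shows "exponential_law r = gibbs_law (\<lambda>_. r)"
proof -
  interpret gibbs_potential "\<lambda>_. r" r r 0
    by unfold_locales (use r in auto)
  have weight: "weight x = exp (- r * x)" if "0 \<le> x" for x
    using that by (simp add: weight_def mult.commute)
  have "set_integrable lborel {0..} weight" using set_integrable_weight[of "\<lambda>_. 1" 1] by simp
  then have "mass = integral {0..} weight"
    unfolding mass_def by (rule set_borel_integral_eq_integral)
  also have "\<dots> = integral {0..} (\<lambda>x. exp (- r * x))"
    by (intro Henstock_Kurzweil_Integration.integral_cong) (simp add: weight)
  also have "\<dots> = 1 / r"
    using has_integral_exp_minus_to_infinity[OF r, of 0] by (simp add: integral_unique)
  finally have "exponential_density r x = gibbs_density (\<lambda>_. r) x" for x
    using r by (auto simp: exponential_density_def gibbs_density_eq weight mult.commute)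
  then show ?thesis by (simp add: exponential_law_def gibbs_law_def)
qed

section \<open>Uniform continuity and limits along a filter\<close>

lemma uniformly_continuous_on_mult_bounded:
  fixes f g :: "real \<Rightarrow> real"
  assumes "uniformly_continuous_on S f" "uniformly_continuous_on S g"
    and F: "\<And>x. x \<in> S \<Longrightarrow> \<bar>f x\<bar> \<le> F" and G: "\<And>x. x \<in> S \<Longrightarrow> \<bar>g x\<bar> \<le> G"
  shows "uniformly_continuous_on S (\<lambda>x. f x * g x)"
  unfolding uniformly_continuous_on_def
proof (intro allI impI)
  fix e :: real assume e: "0 < e"
  define c where "c = e / (\<bar>F\<bar> + \<bar>G\<bar> + 1)"
  have c: "0 < c" using e by (simp add: c_def add_nonneg_pos)
  obtain d1 d2 where d1: "0 < d1" "\<And>x y. x \<in> S \<Longrightarrow> y \<in> S \<Longrightarrow> dist y x < d1 \<Longrightarrow> dist (f y) (f x) < c"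
    and d2: "0 < d2" "\<And>x y. x \<in> S \<Longrightarrow> y \<in> S \<Longrightarrow> dist y x < d2 \<Longrightarrow> dist (g y) (g x) < c"
    using assms(1,2) c unfolding uniformly_continuous_on_def by metis
  show "\<exists>d>0. \<forall>x\<in>S. \<forall>y\<in>S. dist y x < d \<longrightarrow> dist (f y * g y) (f x * g x) < e"
  proof (intro exI conjI ballI impI)
    show "0 < min d1 d2" using d1 d2 by simp
    fix x y assume xy: "x \<in> S" "y \<in> S" "dist y x < min d1 d2"
    have "dist (f y * g y) (f x * g x) = \<bar>f y * (g y - g x) + (f y - f x) * g x\<bar>"
      by (simp add: dist_real_def algebra_simps)
    also have "\<dots> \<le> \<bar>f y\<bar> * \<bar>g y - g x\<bar> + \<bar>f y - f x\<bar> * \<bar>g x\<bar>"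
      by (metis abs_mult abs_triangle_ineq)
    also have "\<dots> \<le> \<bar>F\<bar> * c + c * \<bar>G\<bar>"
      using d1(2)[of x y] d2(2)[of x y] xy F[of y] G[of x] c
      by (intro add_mono mult_mono) (auto simp: dist_real_def)
    also have "\<dots> < c * (\<bar>F\<bar> + \<bar>G\<bar> + 1)" using c by (simp add: algebra_simps)
    also have "\<dots> = e" by (simp add: c_def add_nonneg_pos less_imp_neq[THEN not_sym])
    finally show "dist (f y * g y) (f x * g x) < e" .
  qed
qed

lemma uniformly_continuous_on_bounded_derivative:
  fixes w v :: "real \<Rightarrow> real"
  assumes "convex S" "\<And>x. x \<in> S \<Longrightarrow> (w has_real_derivative v x) (at x within S)"
    and L: "\<And>x. x \<in> S \<Longrightarrow> \<bar>v x\<bar> \<le> L"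
  shows "uniformly_continuous_on S w"
proof (rule lipschitz_on_uniformly_continuous)
  show "(max L 0)-lipschitz_on S w"
  proof (rule lipschitz_onI)
    fix x y assume "x \<in> S" "y \<in> S"
    then have "norm (w x - w y) \<le> max L 0 * norm (x - y)"
      using assms by (intro field_differentiable_bound[of S w v]) (auto simp: le_max_iff_disj)
    then show "dist (w x) (w y) \<le> max L 0 * dist x y" by (simp add: dist_norm)
  qed simp
qed

lemma uniformly_continuous_eventually_modulus:
  fixes v :: "real \<Rightarrow> real" and r :: "'i \<Rightarrow> real"
  assumes "uniformly_continuous_on {0..} v" "(r \<longlongrightarrow> 0) F" "0 < e"
  shows "\<forall>\<^sub>F i in F. \<forall>x y. 0 \<le> x \<longrightarrow> 0 \<le> y \<longrightarrow> \<bar>x - y\<bar> \<le> r i * M \<longrightarrow> \<bar>v x - v y\<bar> \<le> e"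
proof -
  obtain d where d: "0 < d" "\<And>x y. 0 \<le> x \<Longrightarrow> 0 \<le> y \<Longrightarrow> dist y x < d \<Longrightarrow> dist (v y) (v x) < e"
    using assms(1,3) unfolding uniformly_continuous_on_def by (metis atLeast_iff)
  have "((\<lambda>i. r i * M) \<longlongrightarrow> 0) F" using tendsto_mult_left_zero[OF assms(2)] .
  from order_tendstoD(2)[OF this d(1)] show ?thesis
  proof eventually_elim
    case (elim i)
    show ?case
    proof (intro allI impI)
      fix x y :: real assume "0 \<le> x" "0 \<le> y" "\<bar>x - y\<bar> \<le> r i * M"
      then have "dist (v x) (v y) < e" using elim by (intro d(2)) (auto simp: dist_real_def)
      then show "\<bar>v x - v y\<bar> \<le> e" by (simp add: dist_real_def)
    qed
  qed
qed

text \<open>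
  The constant may have either sign, which spares the proof that a sum of error terms is
  nonnegative.
\<close>
lemma tendsto_eventually_le_const_mult:
  fixes f :: "'i \<Rightarrow> real"
  assumes "\<And>e. 0 < e \<Longrightarrow> \<forall>\<^sub>F i in F. \<bar>f i - l\<bar> \<le> C * e"
  shows "(f \<longlongrightarrow> l) F"
proof (rule tendstoI)
  fix e :: real assume e: "0 < e"
  have "\<forall>\<^sub>F i in F. \<bar>f i - l\<bar> \<le> C * (e / (\<bar>C\<bar> + 1))"
    using e by (intro assms divide_pos_pos) auto
  moreover have "C * (e / (\<bar>C\<bar> + 1)) < e"
  proof -
    have "C * e < (\<bar>C\<bar> + 1) * e" using e by (intro mult_strict_right_mono) auto
    then show ?thesis by (simp add: pos_divide_less_eq mult.commute)
  qed
  ultimately show "\<forall>\<^sub>F i in F. dist (f i) l < e"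
    by (auto elim!: eventually_mono simp: dist_real_def)
qed

lemma uniformly_continuous_on_half_line:
  fixes f :: "real \<Rightarrow> real"
  assumes cont: "continuous_on {0..} f" and lim: "(f \<longlongrightarrow> l) at_top"
  shows "uniformly_continuous_on {0..} f"
  unfolding uniformly_continuous_on_def
proof (intro allI impI)
  fix e :: real assume e: "0 < e"
  have "\<forall>\<^sub>F x in at_top. dist (f x) l < e / 2" using tendstoD[OF lim, of "e / 2"] e by simp
  then obtain R where R: "\<And>x. R \<le> x \<Longrightarrow> dist (f x) l < e / 2" by (auto simp: eventually_at_top_linorder)
  have "uniformly_continuous_on {0..R + 1} f"
    by (intro compact_uniformly_continuous continuous_on_subset[OF cont]) auto
  then obtain d where d: "0 < d" "\<And>x y. x \<in> {0..R + 1} \<Longrightarrow> y \<in> {0..R + 1} \<Longrightarrow> dist y x < d \<Longrightarrow> dist (f y) (f x) < e"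
    using e unfolding uniformly_continuous_on_def by metis
  show "\<exists>d>0. \<forall>x\<in>{0..}. \<forall>y\<in>{0..}. dist y x < d \<longrightarrow> dist (f y) (f x) < e"
  proof (intro exI conjI ballI impI)
    show "0 < min d 1" using d by simp
    fix x y :: real assume xy: "x \<in> {0..}" "y \<in> {0..}" "dist y x < min d 1"
    show "dist (f y) (f x) < e"
    proof (cases "x \<le> R + 1 \<and> y \<le> R + 1")
      case True
      then show ?thesis using d xy by auto
    next
      case False
      then have "R \<le> x" "R \<le> y" using xy by (auto simp: dist_real_def)
      then show ?thesis using R[of x] R[of y] by (metis dist_commute dist_triangle_half_l)
    qed
  qed
qed

text \<open>
  Splitting at \<open>t + d\<close>: below this level \<open>f\<close> is small and the total weight bounded, above it \<open>f\<close> is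
  bounded and the weight small. The weight \<open>\<theta>\<close> is \<open>1\<close> for the error in the test function and the
  scaled service surplus for the drift term.
\<close>
lemma vanishing_expectation:
  fixes p :: "'i \<Rightarrow> nat pmf" and X \<theta> :: "'i \<Rightarrow> nat \<Rightarrow> real"
  assumes \<theta>: "\<forall>\<^sub>F i in F. \<forall>q. 0 \<le> \<theta> i q" "\<forall>\<^sub>F i in F. integrable (measure_pmf (p i)) (\<theta> i)"
      "\<forall>\<^sub>F i in F. measure_pmf.expectation (p i) (\<theta> i) \<le> C"
    and tail: "\<And>d. 0 < d \<Longrightarrow>
      ((\<lambda>i. measure_pmf.expectation (p i) (\<lambda>q. \<theta> i q * indicator {t + d..} (X i q))) \<longlongrightarrow> 0) F"
    and f: "\<And>x. 0 \<le> x \<Longrightarrow> \<bar>f x\<bar> \<le> W" "\<And>e. 0 < e \<Longrightarrow> \<exists>d>0. \<forall>x. 0 \<le> x \<longrightarrow> x < t + d \<longrightarrow> \<bar>f x\<bar> \<le> (e::real)"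
    and X: "\<forall>\<^sub>F i in F. \<forall>q. 0 \<le> X i q"
  shows "((\<lambda>i. measure_pmf.expectation (p i) (\<lambda>q. \<theta> i q * f (X i q))) \<longlongrightarrow> 0) F"
proof (rule tendsto_eventually_le_const_mult)
  fix e :: real assume e: "0 < e"
  obtain d where d: "0 < d" "\<And>x. 0 \<le> x \<Longrightarrow> x < t + d \<Longrightarrow> \<bar>f x\<bar> \<le> e" using f(2)[OF e] by auto
  have W: "0 \<le> W" using f(1)[of 0] by simp
  show "\<forall>\<^sub>F i in F. \<bar>measure_pmf.expectation (p i) (\<lambda>q. \<theta> i q * f (X i q)) - 0\<bar> \<le> (C + W) * e"
    using \<theta> X order_tendstoD(2)[OF tail[OF d(1)] e]
  proof eventually_elim
    case (elim i)
    let ?t = "\<lambda>q. \<theta> i q * indicator {t + d..} (X i q)"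
    have it: "integrable (measure_pmf (p i)) ?t"
      by (rule Bochner_Integration.integrable_bound[OF elim(2)]) (auto split: split_indicator)
    have "\<bar>measure_pmf.expectation (p i) (\<lambda>q. \<theta> i q * f (X i q))\<bar> \<le>
      measure_pmf.expectation (p i) (\<lambda>q. e * \<theta> i q + W * ?t q)"
    proof (rule expectation_pmf_abs_le)
      fix q
      have "\<bar>f (X i q)\<bar> \<le> e + W * indicator {t + d..} (X i q)"
        using d(2)[of "X i q"] f(1)[of "X i q"] elim(4) e W by (auto split: split_indicator)
      from mult_left_mono[OF this, of "\<theta> i q"]
      show "\<bar>\<theta> i q * f (X i q)\<bar> \<le> e * \<theta> i q + W * ?t q"
        using elim(1) by (simp add: abs_mult algebra_simps)
    qed (use elim(2) it in auto)
    also have "\<dots> = e * measure_pmf.expectation (p i) (\<theta> i) + W * measure_pmf.expectation (p i) ?t"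
      using elim(2) it by simp
    also have "\<dots> \<le> e * C + W * e"
      using elim(3,5) e W by (intro add_mono mult_left_mono) auto
    finally show ?case by (simp add: algebra_simps)
  qed
qed

section \<open>Convergence to a Gibbs law\<close>

text \<open>
  The convergence of the scaled surplus \<open>b'\<close> to \<open>b\<close> is weighted with \<open>min 1 x\<close>, since it is multiplied by
  a solution \<open>w\<close> of the Stein equation that is bounded and vanishes linearly at zero. This admits a
  \<open>b'\<close> that differs from \<open>b\<close> on an interval shrinking to the origin.
\<close>
lemma queue_gibbs_limit:
  fixes A S :: "'i \<Rightarrow> nat \<Rightarrow> nat pmf" and \<epsilon> :: "'i \<Rightarrow> real" and b h :: "real \<Rightarrow> real"
  assumes queue: "\<forall>\<^sub>F i in F. stationary_queue (A i) (S i) (\<pi> i) M"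
    and integrable: "\<forall>\<^sub>F i in F. integrable (measure_pmf (\<pi> i)) real"
    and \<epsilon>: "\<forall>\<^sub>F i in F. 0 < \<epsilon> i" "(\<epsilon> \<longlongrightarrow> 0) F"
    and surplus: "\<forall>\<^sub>F i in F. \<forall>q. stationary_queue.service_surplus (A i) (S i) q = \<epsilon> i * b' i (\<epsilon> i * real q)"
    and b'_bound: "\<forall>\<^sub>F i in F. \<forall>x\<ge>0. \<bar>b' i x\<bar> \<le> B"
    and b'_lim: "\<And>e. 0 < e \<Longrightarrow> \<forall>\<^sub>F i in F. \<forall>x\<ge>0. min 1 x * \<bar>b' i x - b x\<bar> \<le> e"
    and net_square: "\<And>e. 0 < e \<Longrightarrow> \<forall>\<^sub>F i in F. \<forall>q. \<bar>stationary_queue.net_square (A i) (S i) q - 2 * c\<bar> \<le> e"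
    and c: "0 < c"
    and b: "uniformly_continuous_on {0..} b" "\<And>x. 0 \<le> x \<Longrightarrow> \<bar>b x\<bar> \<le> B" "0 < \<beta>" "0 \<le> K" "\<And>x. K < x \<Longrightarrow> \<beta> \<le> b x"
    and h: "uniformly_continuous_on UNIV h" "\<And>x. \<bar>h x\<bar> \<le> H"
  shows "((\<lambda>i. measure_pmf.expectation (\<pi> i) (\<lambda>q. h (\<epsilon> i * real q))) \<longlongrightarrow>
    integral\<^sup>L (gibbs_law (\<lambda>x. b x / c)) h) F"
proof -
  define m where "m = integral\<^sup>L (gibbs_law (\<lambda>x. b x / c)) h"
  interpret gibbs_potential "\<lambda>x. b x / c" "B / c" "\<beta> / c" K
    using b c uniformly_continuous_imp_continuous[OF b(1)]
    by unfold_locales (auto intro!: continuous_intros divide_right_mono)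
  obtain w W where w0: "w 0 = 0" and W: "\<And>x. 0 \<le> x \<Longrightarrow> \<bar>w x\<bar> \<le> W"
    and w: "\<And>x. 0 \<le> x \<Longrightarrow> (w has_real_derivative h x - m + b x / c * w x) (at x within {0..})"
    unfolding m_def
    using stein_equation[OF uniformly_continuous_imp_continuous[OF h(1)] h(2)] by metis
  define v where "v = (\<lambda>x. h x - m + b x / c * w x)"
  define L where "L = H + \<bar>m\<bar> + B / c * W"
  have W0: "0 \<le> W" and B0: "0 \<le> B" using W[of 0] b(2)[of 0] by auto
  have L: "\<bar>v x\<bar> \<le> L" if "0 \<le> x" for x
  proof -
    have "\<bar>b x / c * w x\<bar> \<le> B / c * W"
      unfolding abs_mult using b(2)[OF that] W[OF that] c B0
      by (intro mult_mono) (auto intro!: divide_right_mono)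
    then show ?thesis using h(2)[of x] unfolding v_def L_def by linarith
  qed
  have L0: "0 \<le> L" using L[of 0] by simp
  have w_deriv: "(w has_real_derivative v x) (at x within {0..})" if "0 \<le> x" for x
    using w[OF that] by (simp add: v_def)
  \<comment> \<open>Boundedness covers \<open>x \<ge> 1\<close>, the derivative bound and \<open>w 0 = 0\<close> cover \<open>x \<le> 1\<close>.\<close>
  have w_min: "\<bar>w x\<bar> \<le> (W + L) * min 1 x" if "0 \<le> x" for x
  proof -
    have "\<bar>w x\<bar> \<le> L * x"
      using field_differentiable_bound[of "{0..}" w v L x 0] w_deriv L that by (auto simp: w0)
    moreover have "0 \<le> W * x" using W0 that by simp
    ultimately show ?thesis using W[OF that] L0 by (auto simp: min_def algebra_simps)
  qed
  have v_uc: "uniformly_continuous_on {0..} v"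
  proof -
    have "uniformly_continuous_on {0..} w"
      using w_deriv L by (intro uniformly_continuous_on_bounded_derivative[of _ w v L]) auto
    moreover have "uniformly_continuous_on {0..} (\<lambda>x. b x / c)"
      unfolding divide_inverse by (intro uniformly_continuous_on_cmul_right b)
    ultimately have "uniformly_continuous_on {0..} (\<lambda>x. b x / c * w x)"
      using W g_bound by (intro uniformly_continuous_on_mult_bounded[where F="B / c" and G=W]) auto
    moreover have "uniformly_continuous_on {0..} (\<lambda>x. h x - m)"
    proof (intro uniformly_continuous_on_diff uniformly_continuous_on_const)
      show "uniformly_continuous_on {0..} h"
        using h(1) unfolding uniformly_continuous_on_def by (meson UNIV_I)
    qed
    ultimately show ?thesis unfolding v_def by (rule uniformly_continuous_on_add[rotated])
  qed
  show ?thesis unfolding m_def[symmetric]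
  proof (rule tendsto_eventually_le_const_mult)
    fix e :: real assume e: "0 < e"
    have "((\<lambda>i. 2 * L * M * B * \<epsilon> i) \<longlongrightarrow> 0) F" using tendsto_mult_right_zero[OF \<epsilon>(2)] .
    from order_tendstoD(2)[OF this e]
    have small: "\<forall>\<^sub>F i in F. 2 * L * M * B * \<epsilon> i < e" .
    show "\<forall>\<^sub>F i in F. \<bar>measure_pmf.expectation (\<pi> i) (\<lambda>q. h (\<epsilon> i * real q)) - m\<bar> \<le>
        ((1 + M\<^sup>2 + L / 2 + (W + L)) / c) * e"
      using queue integrable \<epsilon>(1) surplus b'_bound b'_lim[OF e] net_square[OF e] small
        uniformly_continuous_eventually_modulus[OF v_uc \<epsilon>(2) e, of M]
    proof eventually_elim
      case (elim i)
      interpret stationary_queue "A i" "S i" "\<pi> i" M by (rule elim)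
      let ?E = "measure_pmf.expectation (\<pi> i)"
      let ?x = "\<lambda>q. \<epsilon> i * real q"
      have x: "0 \<le> ?x q" for q using elim by simp
      have b'w: "\<bar>w (?x q) * b' i (?x q)\<bar> \<le> W * B" for q
        unfolding abs_mult using W[OF x, of q] elim(5) x[of q] W0 by (intro mult_mono) auto
      have vn: "\<bar>v (?x q) * net_square q\<bar> \<le> L * M\<^sup>2" for q
        unfolding abs_mult using L[OF x, of q] L0 net_square_bound[of q] by (intro mult_mono) auto
      have vn': "\<bar>v (?x q) * (net_square q - 2 * c)\<bar> \<le> L * e" for q
        unfolding abs_mult using L[OF x, of q] L0 elim(7) by (intro mult_mono) auto
      have wb: "\<bar>w (?x q) * (b' i (?x q) - b (?x q))\<bar> \<le> (W + L) * e" for q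
      proof -
        have "\<bar>w (?x q)\<bar> * \<bar>b' i (?x q) - b (?x q)\<bar> \<le>
            ((W + L) * min 1 (?x q)) * \<bar>b' i (?x q) - b (?x q)\<bar>"
          by (intro mult_right_mono w_min x) auto
        also have "\<dots> \<le> (W + L) * e"
          using elim(6) x[of q] W0 L0 by (auto simp: mult.assoc intro!: mult_left_mono)
        finally show ?thesis by (simp add: abs_mult)
      qed
      have ints: "integrable (measure_pmf (\<pi> i)) (\<lambda>q. w (?x q) * b' i (?x q))"
        "integrable (measure_pmf (\<pi> i)) (\<lambda>q. v (?x q) * net_square q)"
        "integrable (measure_pmf (\<pi> i)) (\<lambda>q. v (?x q) * (net_square q - 2 * c))"
        "integrable (measure_pmf (\<pi> i)) (\<lambda>q. w (?x q) * (b' i (?x q) - b (?x q)))"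
        "integrable (measure_pmf (\<pi> i)) (\<lambda>q. h (?x q))"
        by (rule integrable_pmf_bounded, rule b'w vn vn' wb h(2))+
      have surplus_bound: "?E service_surplus \<le> \<epsilon> i * B"
      proof -
        have "\<bar>service_surplus q\<bar> \<le> \<epsilon> i * B" for q
          using elim(3,4,5) x[of q] by (auto simp: abs_mult)
        from expectation_pmf_abs_le[of "\<pi> i" "\<lambda>_. \<epsilon> i * B" service_surplus, OF _ this]
        show ?thesis by simp
      qed
      have "?E (\<lambda>q. w (?x q) * service_surplus q) / \<epsilon> i = ?E (\<lambda>q. w (?x q) * b' i (?x q))"
      proof -
        have "?E (\<lambda>q. w (?x q) * service_surplus q) = ?E (\<lambda>q. \<epsilon> i * (w (?x q) * b' i (?x q)))"
          using elim(4) by (simp add: mult_ac)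
        then show ?thesis using elim(3) by simp
      qed
      then have gen: "\<bar>?E (\<lambda>q. w (?x q) * b' i (?x q)) - ?E (\<lambda>q. v (?x q) * net_square q) / 2\<bar> \<le> e + e * M\<^sup>2"
      proof -
        have "2 * L * M * ?E service_surplus \<le> 2 * L * M * (\<epsilon> i * B)"
          using surplus_bound L0 M_nonneg by (intro mult_left_mono) auto
        also have "\<dots> \<le> e" using elim(8) by (simp add: mult_ac)
        finally show ?thesis
          using generator_estimate[of "\<epsilon> i" w v W L e, OF elim(2) elim(3) w_deriv w0 W L] elim(9)
            \<open>?E (\<lambda>q. w (?x q) * service_surplus q) / \<epsilon> i = _\<close> by (auto simp: mult.commute)
      qed
      \<comment> \<open>The Stein equation, with the limiting coefficients replaced by those of the queue.\<close>
      have "c * (?E (\<lambda>q. h (?x q)) - m) = ?E (\<lambda>q. c * (h (?x q) - m))"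
        using ints by simp
      also have "\<dots> = ?E (\<lambda>q. (v (?x q) * net_square q) / 2 - w (?x q) * b' i (?x q) -
          (v (?x q) * (net_square q - 2 * c)) / 2 + w (?x q) * (b' i (?x q) - b (?x q)))"
        using c by (intro arg_cong[where f="?E"] ext) (simp add: v_def field_simps)
      also have "\<dots> = ?E (\<lambda>q. v (?x q) * net_square q) / 2 - ?E (\<lambda>q. w (?x q) * b' i (?x q)) -
          ?E (\<lambda>q. v (?x q) * (net_square q - 2 * c)) / 2 + ?E (\<lambda>q. w (?x q) * (b' i (?x q) - b (?x q)))"
        using ints by simp
      finally have eq: "c * (?E (\<lambda>q. h (?x q)) - m) =
          ?E (\<lambda>q. v (?x q) * net_square q) / 2 - ?E (\<lambda>q. w (?x q) * b' i (?x q)) -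
          ?E (\<lambda>q. v (?x q) * (net_square q - 2 * c)) / 2 + ?E (\<lambda>q. w (?x q) * (b' i (?x q) - b (?x q)))" .
      have "\<bar>?E (\<lambda>q. v (?x q) * (net_square q - 2 * c))\<bar> \<le> L * e"
        "\<bar>?E (\<lambda>q. w (?x q) * (b' i (?x q) - b (?x q)))\<bar> \<le> (W + L) * e"
        using expectation_pmf_abs_le[of "\<pi> i" "\<lambda>_. L * e", OF _ vn']
          expectation_pmf_abs_le[of "\<pi> i" "\<lambda>_. (W + L) * e", OF _ wb] by simp_all
      then have "\<bar>c * (?E (\<lambda>q. h (?x q)) - m)\<bar> \<le> e + e * M\<^sup>2 + L * e / 2 + (W + L) * e"
        unfolding eq using gen by linarith
      moreover have "\<bar>c * (?E (\<lambda>q. h (?x q)) - m)\<bar> = c * \<bar>?E (\<lambda>q. h (?x q)) - m\<bar>"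
        using c by (simp add: abs_mult)
      ultimately have "c * \<bar>?E (\<lambda>q. h (?x q)) - m\<bar> \<le> (1 + M\<^sup>2 + L / 2 + (W + L)) * e"
        by (simp add: distrib_right mult.commute[of e])
      then show ?case using c by (simp add: field_simps)
    qed
  qed
qed

section \<open>Convergence to a uniform law\<close>

lemma integral_uniform_measure_Icc:
  fixes h :: "real \<Rightarrow> real"
  assumes [measurable]: "h \<in> borel_measurable borel" and "a < b"
  shows "integral\<^sup>L (uniform_measure lborel {a..b}) h = (LBINT x:{a..b}. h x) / (b - a)"
proof -
  have "uniform_measure lborel {a..b} = density lborel (\<lambda>x. ennreal (indicator {a..b} x / (b - a)))"
    unfolding uniform_measure_def using assms(2)
    by (intro arg_cong[where f="density lborel"] ext) (auto simp: divide_ennreal split: split_indicator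
       simp flip: ennreal_1)
  then have "integral\<^sup>L (uniform_measure lborel {a..b}) h = (\<integral>x. (indicator {a..b} x / (b - a)) *\<^sub>R h x \<partial>lborel)"
    using assms(2) by (simp add: integral_density)
  also have "\<dots> = (\<integral>x. (indicator {a..b} x *\<^sub>R h x) / (b - a) \<partial>lborel)"
    by (intro Bochner_Integration.integral_cong) auto
  finally show ?thesis by (simp add: set_lebesgue_integral_def)
qed

text \<open>
  The variance is only asked to be close to \<open>2 * c\<close> at queue lengths with small surplus. As the mean
  surplus tends to zero, Markov's inequality makes the remaining queue lengths improbable; this also
  covers a family in which \<open>\<epsilon>\<close> does not tend to zero.
\<close>
lemma queue_uniform_limit:
  fixes A S :: "'i \<Rightarrow> nat \<Rightarrow> nat pmf" and \<epsilon> \<tau> :: "'i \<Rightarrow> real" and \<psi> h :: "real \<Rightarrow> real"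
  assumes queue: "\<forall>\<^sub>F i in F. stationary_queue (A i) (S i) (\<pi> i) M"
    and integrable: "\<forall>\<^sub>F i in F. integrable (measure_pmf (\<pi> i)) real"
    and \<epsilon>: "\<forall>\<^sub>F i in F. 0 < \<epsilon> i" and \<tau>: "filterlim \<tau> at_top F" "filterlim (\<lambda>i. \<epsilon> i * \<tau> i) at_top F"
    and surplus: "\<forall>\<^sub>F i in F. \<forall>q. stationary_queue.service_surplus (A i) (S i) q = \<epsilon> i * \<psi> (real q / \<tau> i)"
    and \<psi>: "\<And>x y. 0 \<le> x \<Longrightarrow> x \<le> y \<Longrightarrow> \<psi> x \<le> \<psi> y" "\<And>x. 0 \<le> x \<Longrightarrow> x \<le> t \<Longrightarrow> \<psi> x = 0"
      "\<And>x. t < x \<Longrightarrow> 0 < \<psi> x" and t: "0 < t"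
    and net_square: "\<And>e. 0 < e \<Longrightarrow> \<exists>\<kappa>>0. \<forall>\<^sub>F i in F. \<forall>q. \<epsilon> i * \<psi> (real q / \<tau> i) < \<kappa> \<longrightarrow>
      \<bar>stationary_queue.net_square (A i) (S i) q - 2 * c\<bar> \<le> e"
    and c: "0 < c"
    and h: "continuous_on UNIV h" "\<And>x. \<bar>h x\<bar> \<le> H"
  shows "((\<lambda>i. measure_pmf.expectation (\<pi> i) (\<lambda>q. h (real q / \<tau> i))) \<longlongrightarrow>
    integral\<^sup>L (uniform_measure lborel {0..t}) h) F"
proof -
  define X where "X = (\<lambda>i q. real q / \<tau> i)"
  have \<tau>_pos: "\<forall>\<^sub>F i in F. 0 < \<tau> i"
    using \<tau>(1) by (simp add: filterlim_at_top_dense)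
  have X0: "\<forall>\<^sub>F i in F. \<forall>q. 0 \<le> X i q"
    using \<tau>_pos by eventually_elim (simp add: X_def)
  have \<psi>0: "0 \<le> \<psi> x" if "0 \<le> x" for x
    using \<psi>(2,3)[of x] that by (cases "x \<le> t") (auto intro: less_imp_le)
  have inverse_\<tau>: "((\<lambda>i. 1 / \<tau> i) \<longlongrightarrow> 0) F"
    using tendsto_inverse_0_at_top[OF \<tau>(1)] by (simp add: inverse_eq_divide)
  let ?\<rho> = "\<lambda>i. stationary_queue.service_surplus (A i) (S i)"
  let ?E = "\<lambda>i. measure_pmf.expectation (\<pi> i)"
  define C where "C = M\<^sup>2 / t"
  have \<rho>: "\<forall>\<^sub>F i in F. (\<forall>q. 0 \<le> ?\<rho> i q) \<and> integrable (measure_pmf (\<pi> i)) (?\<rho> i)"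
    using queue surplus \<epsilon> X0
  proof eventually_elim
    case (elim i)
    interpret stationary_queue "A i" "S i" "\<pi> i" M by (rule elim)
    show ?case using elim(2-) \<psi>0
      by (auto simp: X_def intro!: integrable_pmf_bounded[where B=M] service_surplus_bound)
  qed
  have \<rho>_mean: "\<forall>\<^sub>F i in F. \<tau> i * ?E i (?\<rho> i) \<le> C"
    using queue integrable \<tau>_pos surplus filterlim_at_top_dense[THEN iffD1, OF \<tau>(1), rule_format, of "2 * M / t"]
  proof eventually_elim
    case (elim i)
    interpret stationary_queue "A i" "S i" "\<pi> i" M by (rule elim)
    define N where "N = t * \<tau> i"
    have N: "2 * M < N" "0 < N" using elim t M_nonneg by (auto simp: N_def field_simps)
    have "service_surplus q = 0" if "real q < N" for q
      using elim(3,4) that \<psi>(2)[of "real q / \<tau> i"] by (auto simp: N_def field_simps)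
    then have "measure_pmf.expectation slot unused \<le> M\<^sup>2 / (2 * (N - M))"
      using N M_nonneg by (intro expected_unused_le) auto
    then have "?E i service_surplus \<le> M\<^sup>2 / (2 * (N - M))"
      by (simp add: expected_unused elim)
    also have "\<dots> \<le> M\<^sup>2 / N" using N M_nonneg by (intro divide_left_mono) auto
    finally show ?case using elim(3) t by (simp add: N_def C_def field_simps)
  qed
  have \<rho>_tendsto: "((\<lambda>i. ?E i (?\<rho> i)) \<longlongrightarrow> 0) F"
  proof (rule tendsto_sandwich)
    show "\<forall>\<^sub>F i in F. 0 \<le> ?E i (?\<rho> i)" using \<rho> by eventually_elim (auto intro: integral_nonneg_AE)
    show "\<forall>\<^sub>F i in F. ?E i (?\<rho> i) \<le> C * (1 / \<tau> i)"
      using \<rho>_mean \<tau>_pos by eventually_elim (simp add: field_simps)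
    show "((\<lambda>i. C * (1 / \<tau> i)) \<longlongrightarrow> 0) F" using tendsto_mult_right_zero[OF inverse_\<tau>] .
  qed simp
  have X_tail: "((\<lambda>i. ?E i (\<lambda>q. (1::real) * indicator {t + d..} (X i q))) \<longlongrightarrow> 0) F" if d: "0 < d" for d
  proof (rule tendsto_sandwich)
    let ?k = "\<psi> (t + d)"
    have k: "0 < ?k" using \<psi>(3) d by simp
    show "\<forall>\<^sub>F i in F. 0 \<le> ?E i (\<lambda>q. (1::real) * indicator {t + d..} (X i q))"
      by (auto intro: integral_nonneg_AE)
    show "\<forall>\<^sub>F i in F. ?E i (\<lambda>q. (1::real) * indicator {t + d..} (X i q)) \<le> (C / ?k) * inverse (\<epsilon> i * \<tau> i)"
      using \<rho> \<rho>_mean \<tau>_pos \<epsilon> surplus X0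
    proof eventually_elim
      case (elim i)
      have "\<epsilon> i * ?k * ?E i (\<lambda>q. (1::real) * indicator {t + d..} (X i q)) =
          ?E i (\<lambda>q. \<epsilon> i * ?k * indicator {t + d..} (X i q))" by simp
      also have "\<dots> \<le> ?E i (?\<rho> i)"
      proof (rule expectation_pmf_mono)
        show "integrable (measure_pmf (\<pi> i)) (\<lambda>q. \<epsilon> i * ?k * indicator {t + d..} (X i q))"
          using elim k by (intro integrable_pmf_bounded[where B="\<epsilon> i * ?k"]) (auto split: split_indicator)
        fix q
        show "\<epsilon> i * ?k * indicator {t + d..} (X i q) \<le> ?\<rho> i q"
          using elim \<psi>(1)[of "t + d" "X i q"] \<psi>0[of "X i q"] t d by (auto simp: X_def split: split_indicator)
      qed (use elim in auto)
      also have "\<dots> \<le> C / \<tau> i" using elim by (simp add: field_simps)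
      finally show ?case using elim k by (simp add: field_simps)
    qed
    show "((\<lambda>i. (C / ?k) * inverse (\<epsilon> i * \<tau> i)) \<longlongrightarrow> 0) F"
      using tendsto_mult_right_zero[OF tendsto_inverse_0_at_top[OF \<tau>(2)]] .
  qed simp
  \<comment> \<open>The overshoot over \<open>(t + d / 2) * \<tau>\<close> is at least \<open>d / 2 * \<tau>\<close> where \<open>X \<ge> t + d\<close>; the extra \<open>M\<close> in the
    probability is less than \<open>d / 4 * \<tau>\<close> for large \<open>\<tau>\<close>.\<close>
  have \<rho>_tail: "((\<lambda>i. ?E i (\<lambda>q. \<tau> i * ?\<rho> i q * indicator {t + d..} (X i q))) \<longlongrightarrow> 0) F" if d: "0 < d" for d
  proof (rule tendsto_sandwich)
    show "\<forall>\<^sub>F i in F. 0 \<le> ?E i (\<lambda>q. \<tau> i * ?\<rho> i q * indicator {t + d..} (X i q))"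
      using \<rho> \<tau>_pos by eventually_elim (auto intro!: integral_nonneg_AE)
    show "\<forall>\<^sub>F i in F. ?E i (\<lambda>q. \<tau> i * ?\<rho> i q * indicator {t + d..} (X i q)) \<le>
        (3 * M\<^sup>2 / d) * ?E i (\<lambda>q. (1::real) * indicator {t + d / 4..} (X i q))"
      using queue \<rho> \<tau>_pos filterlim_at_top_dense[THEN iffD1, OF \<tau>(1), rule_format, of "4 * M / d"]
    proof eventually_elim
      case (elim i)
      interpret stationary_queue "A i" "S i" "\<pi> i" M by (rule elim)
      define N where "N = (t + d / 2) * \<tau> i"
      define D where "D = d / 2 * \<tau> i"
      have "indicator {N + D..} (real q) = (indicator {t + d..} (X i q) :: real)" for q
        using elim(3) by (auto simp: indicator_def X_def N_def D_def field_simps)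
      then have "d * ?E i (\<lambda>q. \<tau> i * service_surplus q * indicator {t + d..} (X i q)) =
          2 * D * ?E i (\<lambda>q. service_surplus q * indicator {N + D..} (real q))"
        by (simp add: D_def mult_ac)
      also have "\<dots> \<le> 3 * M\<^sup>2 * measure_pmf.prob (\<pi> i) {q. N - M < real q}"
        using elim t d by (intro overshoot_tail) (auto simp: N_def D_def)
      also have "\<dots> \<le> 3 * M\<^sup>2 * measure_pmf.prob (\<pi> i) {q. t + d / 4 \<le> X i q}"
      proof (intro mult_left_mono measure_pmf.finite_measure_mono subsetI CollectI)
        fix q assume "q \<in> {q. N - M < real q}"
        then have "(t + d / 2) * \<tau> i - M < real q" by (simp add: N_def)
        moreover have "4 * M < d * \<tau> i" using elim(4) d by (simp add: field_simps)
        ultimately have "(t + d / 4) * \<tau> i \<le> real q" by (simp add: algebra_simps)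
        then show "t + d / 4 \<le> X i q" using elim(3) by (simp add: X_def pos_le_divide_eq)
      qed auto
      also have "measure_pmf.prob (\<pi> i) {q. t + d / 4 \<le> X i q} = ?E i (\<lambda>q. (1::real) * indicator {t + d / 4..} (X i q))"
      proof -
        have "(\<lambda>q. (1::real) * indicator {t + d / 4..} (X i q) :: real) = indicator {q. t + d / 4 \<le> X i q}"
          by (auto simp: indicator_def)
        then show ?thesis by simp
      qed
      finally show ?case using d by (simp add: field_simps)
    qed
    show "((\<lambda>i. (3 * M\<^sup>2 / d) * ?E i (\<lambda>q. (1::real) * indicator {t + d / 4..} (X i q))) \<longlongrightarrow> 0) F"
      using d by (intro tendsto_mult_right_zero X_tail) simp
  qed simp

  define m where "m = integral\<^sup>L (uniform_measure lborel {0..t}) h"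
  have h_cont: "continuous_on T h" for T by (rule continuous_on_subset[OF h(1)]) simp
  have hi: "set_integrable lborel {0..t} h" by (rule borel_integrable_atLeastAtMost'[OF h_cont])
  have m_eq: "m * t = integral {0..t} h"
    using integral_uniform_measure_Icc[of h 0 t] t h(1) set_borel_integral_eq_integral(2)[OF hi]
    by (simp add: m_def borel_measurable_continuous_onI)
  have H0: "0 \<le> H" using h(2)[of 0] by simp
  \<comment> \<open>The Stein solution on \<open>[0, t]\<close>, continued beyond \<open>t\<close> by a ramp of length one. The ramp keeps \<open>v\<close>
    uniformly continuous and \<open>w\<close> bounded.\<close>
  define v where "v = (\<lambda>x. (h (min x t) - m) * max 0 (min 1 (1 - (x - t))))"
  define w where "w = (\<lambda>x. integral {0..x} v)"
  define L where "L = H + \<bar>m\<bar>"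
  have L0: "0 \<le> L" using H0 by (simp add: L_def)
  have v_cont: "continuous_on T v" for T
    unfolding v_def by (intro continuous_intros continuous_on_compose2[OF h(1)]) auto
  have L: "\<bar>v x\<bar> \<le> L" for x
  proof -
    have "\<bar>h (min x t) - m\<bar> * \<bar>max 0 (min 1 (1 - (x - t)))\<bar> \<le> L * 1"
    proof (intro mult_mono)
      show "\<bar>h (min x t) - m\<bar> \<le> L" using h(2)[of "min x t"] unfolding L_def by linarith
    qed (use L0 in auto)
    then show ?thesis by (simp add: v_def abs_mult)
  qed
  have w_deriv: "(w has_real_derivative v x) (at x within {0..})" if "0 \<le> x" for x
    unfolding w_def using that by (intro antiderivative_half_line v_cont)
  have w_lip: "\<bar>w x - w y\<bar> \<le> L * \<bar>x - y\<bar>" if "0 \<le> x" "0 \<le> y" for x y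
    using field_differentiable_bound[of "{0..}" w v L x y] w_deriv L that by auto
  have w0: "w 0 = 0" by (simp add: w_def)
  have wt: "w t = 0"
  proof -
    have "w t = integral {0..t} (\<lambda>x. h x - m)"
      unfolding w_def by (intro Henstock_Kurzweil_Integration.integral_cong) (auto simp: v_def)
    also have "\<dots> = integral {0..t} h - m * t"
      using t by (subst Henstock_Kurzweil_Integration.integral_diff)
         (auto intro!: integrable_continuous_interval h_cont)
    finally show ?thesis using m_eq by simp
  qed
  have w_end: "w x = w (t + 1)" if "t + 1 \<le> x" for x
  proof -
    have "w x = w (t + 1) + integral {t + 1..x} v"
      unfolding w_def using that t
      by (subst Henstock_Kurzweil_Integration.integral_combine) (auto intro!: integrable_continuous_interval v_cont)
    moreover have "integral {t + 1..x} v = integral {t + 1..x} (\<lambda>_. 0)"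
      by (intro Henstock_Kurzweil_Integration.integral_cong) (auto simp: v_def)
    ultimately show ?thesis by simp
  qed
  have W: "\<bar>w x\<bar> \<le> L * (t + 1)" if "0 \<le> x" for x
  proof -
    have "w x = w (min x (t + 1))" using w_end[of x] by (auto simp: min_def)
    moreover have "\<bar>w (min x (t + 1)) - w 0\<bar> \<le> L * \<bar>min x (t + 1) - 0\<bar>"
      using that t by (intro w_lip) auto
    moreover have "L * \<bar>min x (t + 1) - 0\<bar> \<le> L * (t + 1)" using L0 that t by (intro mult_left_mono) auto
    ultimately show ?thesis by (simp add: w0)
  qed
  have v_uc: "uniformly_continuous_on {0..} v"
    unfolding uniformly_continuous_on_def
  proof (intro allI impI)
    fix e :: real assume "0 < e"
    moreover have "uniformly_continuous_on {0..t + 1} v"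
      by (intro compact_uniformly_continuous v_cont) auto
    ultimately obtain d where d: "0 < d"
      "\<And>x y. x \<in> {0..t + 1} \<Longrightarrow> y \<in> {0..t + 1} \<Longrightarrow> dist y x < d \<Longrightarrow> dist (v y) (v x) < e"
      unfolding uniformly_continuous_on_def by metis
    have v_min: "v x = v (min x (t + 1))" for x
      by (auto simp: v_def min_def)
    show "\<exists>d>0. \<forall>x\<in>{0..}. \<forall>y\<in>{0..}. dist y x < d \<longrightarrow> dist (v y) (v x) < e"
    proof (intro exI conjI ballI impI)
      fix x y :: real assume "x \<in> {0..}" "y \<in> {0..}" "dist y x < d"
      then have "dist (v (min y (t + 1))) (v (min x (t + 1))) < e"
        using t by (intro d(2)) (auto simp: dist_real_def min_def)
      then show "dist (v y) (v x) < e" using v_min[of x] v_min[of y] by simp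
    qed (rule d)
  qed

  \<comment> \<open>Below \<open>t\<close> the surplus is zero, so \<open>w\<close> may be set to zero there in the drift term.\<close>
  let ?w = "\<lambda>x. if x \<le> t then 0 else w x"
  have drift_part: "((\<lambda>i. ?E i (\<lambda>q. \<tau> i * ?\<rho> i q * ?w (X i q))) \<longlongrightarrow> 0) F"
  proof (rule vanishing_expectation[where C=C and t=t and W="L * (t + 1)" and f="?w"])
    show "\<forall>\<^sub>F i in F. \<forall>q. 0 \<le> \<tau> i * ?\<rho> i q" using \<rho> \<tau>_pos by eventually_elim auto
    show "\<forall>\<^sub>F i in F. integrable (measure_pmf (\<pi> i)) (\<lambda>q. \<tau> i * ?\<rho> i q)"
      using \<rho> by eventually_elim auto
    show "\<forall>\<^sub>F i in F. ?E i (\<lambda>q. \<tau> i * ?\<rho> i q) \<le> C"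
      using \<rho>_mean by eventually_elim simp
    show "\<bar>if x \<le> t then 0 else w x\<bar> \<le> L * (t + 1)" if "0 \<le> x" for x
      using W[OF that] by auto
    show "\<exists>d>0. \<forall>x. 0 \<le> x \<longrightarrow> x < t + d \<longrightarrow> \<bar>if x \<le> t then 0 else w x\<bar> \<le> e" if e: "0 < e" for e
    proof (intro exI conjI allI impI)
      show "0 < e / (L + 1)" using e L0 by simp
      fix x :: real assume x: "0 \<le> x" "x < t + e / (L + 1)"
      show "\<bar>if x \<le> t then 0 else w x\<bar> \<le> e"
      proof (cases "x \<le> t")
        case False
        then have "\<bar>w x\<bar> \<le> L * (x - t)" using w_lip[of x t] x t by (simp add: wt)
        also have "\<dots> \<le> (L + 1) * (e / (L + 1))" using x L0 False by (intro mult_mono) auto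
        finally show ?thesis using L0 False by simp
      qed (use e in simp)
    qed
  qed (use X0 \<rho>_tail in auto)
  have variance_part: "((\<lambda>i. ?E i (\<lambda>q. v (X i q) * (stationary_queue.net_square (A i) (S i) q - 2 * c))) \<longlongrightarrow> 0) F"
  proof (rule tendsto_eventually_le_const_mult)
    fix e :: real assume e: "0 < e"
    obtain \<kappa> where \<kappa>: "0 < \<kappa>" and ns: "\<forall>\<^sub>F i in F. \<forall>q. \<epsilon> i * \<psi> (real q / \<tau> i) < \<kappa> \<longrightarrow>
      \<bar>stationary_queue.net_square (A i) (S i) q - 2 * c\<bar> \<le> e" using net_square[OF e] by blast
    have ke: "0 < \<kappa> * e" using \<kappa> e by simp
    show "\<forall>\<^sub>F i in F. \<bar>?E i (\<lambda>q. v (X i q) * (stationary_queue.net_square (A i) (S i) q - 2 * c)) - 0\<bar>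
        \<le> (L * (1 + M\<^sup>2 + 2 * c)) * e"
      using queue \<rho> surplus ns order_tendstoD(2)[OF \<rho>_tendsto ke]
    proof eventually_elim
      case (elim i)
      interpret stationary_queue "A i" "S i" "\<pi> i" M by (rule elim)
      have ir: "integrable (measure_pmf (\<pi> i)) service_surplus" using elim by simp
      have "\<bar>?E i (\<lambda>q. v (X i q) * (net_square q - 2 * c))\<bar> \<le>
          ?E i (\<lambda>q. L * (e + (M\<^sup>2 + 2 * c) / \<kappa> * service_surplus q))"
      proof (rule expectation_pmf_abs_le)
        fix q
        have "\<bar>net_square q - 2 * c\<bar> \<le> e + (M\<^sup>2 + 2 * c) / \<kappa> * service_surplus q"
        proof (cases "service_surplus q < \<kappa>")
          case True
          then have "\<bar>net_square q - 2 * c\<bar> \<le> e" using elim by auto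
          moreover have "0 \<le> (M\<^sup>2 + 2 * c) / \<kappa> * service_surplus q" using elim(2) \<kappa> c by auto
          ultimately show ?thesis by linarith
        next
          case False
          have "(M\<^sup>2 + 2 * c) / \<kappa> * \<kappa> \<le> (M\<^sup>2 + 2 * c) / \<kappa> * service_surplus q"
            using False c \<kappa> by (intro mult_left_mono) auto
          then have "M\<^sup>2 + 2 * c \<le> (M\<^sup>2 + 2 * c) / \<kappa> * service_surplus q" using \<kappa> by simp
          then show ?thesis using net_square_bound[of q] c e zero_le_power2[of M] by linarith
        qed
        then show "\<bar>v (X i q) * (net_square q - 2 * c)\<bar> \<le> L * (e + (M\<^sup>2 + 2 * c) / \<kappa> * service_surplus q)"
          unfolding abs_mult using L L0 by (intro mult_mono) auto
      qed (use ir in auto)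
      also have "\<dots> = L * (e + (M\<^sup>2 + 2 * c) / \<kappa> * ?E i service_surplus)" using ir by simp
      also have "\<dots> \<le> L * (e + (M\<^sup>2 + 2 * c) / \<kappa> * (\<kappa> * e))"
        using elim(5) L0 c \<kappa> by (intro mult_left_mono add_mono) auto
      also have "\<dots> = (L * (1 + M\<^sup>2 + 2 * c)) * e" using \<kappa> by (simp add: field_simps)
      finally show ?case by simp
    qed
  qed
  have generator_part: "((\<lambda>i. ?E i (\<lambda>q. \<tau> i * ?\<rho> i q * ?w (X i q)) -
      ?E i (\<lambda>q. v (X i q) * stationary_queue.net_square (A i) (S i) q) / 2) \<longlongrightarrow> 0) F"
  proof (rule tendsto_eventually_le_const_mult)
    fix e :: real assume e: "0 < e"
    have "((\<lambda>i. 2 * L * M * ?E i (?\<rho> i)) \<longlongrightarrow> 0) F" using tendsto_mult_right_zero[OF \<rho>_tendsto] .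
    from order_tendstoD(2)[OF this e]
    have small: "\<forall>\<^sub>F i in F. 2 * L * M * ?E i (?\<rho> i) < e" .
    show "\<forall>\<^sub>F i in F. \<bar>?E i (\<lambda>q. \<tau> i * ?\<rho> i q * ?w (X i q)) -
      ?E i (\<lambda>q. v (X i q) * stationary_queue.net_square (A i) (S i) q) / 2 - 0\<bar> \<le> (1 + M\<^sup>2) * e"
      using queue integrable \<tau>_pos surplus small
        uniformly_continuous_eventually_modulus[OF v_uc inverse_\<tau> e, of M]
    proof eventually_elim
      case (elim i)
      interpret stationary_queue "A i" "S i" "\<pi> i" M by (rule elim)
      have X: "X i q = 1 / \<tau> i * real q" for q by (simp add: X_def)
      have "w (X i q) * service_surplus q = service_surplus q * ?w (X i q)" for q
        using elim(3,4) \<psi>(2)[of "X i q"] by (auto simp: X_def)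
      then have "(\<lambda>q. w (X i q) * service_surplus q) = (\<lambda>q. service_surplus q * ?w (X i q))" by (rule ext)
      moreover have "?E i (\<lambda>q. \<tau> i * service_surplus q * ?w (X i q)) =
          \<tau> i * ?E i (\<lambda>q. service_surplus q * ?w (X i q))"
        by (simp only: mult.assoc integral_mult_right_zero)
      ultimately have "?E i (\<lambda>q. w (X i q) * service_surplus q) / (1 / \<tau> i) =
          ?E i (\<lambda>q. \<tau> i * service_surplus q * ?w (X i q))"
        by simp
      moreover have "\<bar>?E i (\<lambda>q. w (1 / \<tau> i * real q) * service_surplus q) / (1 / \<tau> i) -
          ?E i (\<lambda>q. v (1 / \<tau> i * real q) * net_square q) / 2\<bar> \<le> 2 * L * M * ?E i service_surplus + e * M\<^sup>2"
        by (rule generator_estimate[OF elim(2) _ w_deriv w0 W L]) (use elim(3,6) in auto)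
      ultimately have "\<bar>?E i (\<lambda>q. \<tau> i * service_surplus q * ?w (X i q)) -
          ?E i (\<lambda>q. v (X i q) * net_square q) / 2\<bar> \<le> 2 * L * M * ?E i service_surplus + e * M\<^sup>2"
        unfolding X[symmetric] by (simp only:)
      also have "\<dots> \<le> e + e * M\<^sup>2" using elim(5) by simp
      finally show ?case by (simp only: diff_zero distrib_right mult_1 mult.commute[of e])
    qed
  qed
  \<comment> \<open>Drift term, generator estimate and variance term together leave \<open>c * E [v (X)]\<close>.\<close>
  have v_mean: "((\<lambda>i. ?E i (\<lambda>q. v (X i q))) \<longlongrightarrow> 0) F"
  proof -
    have "((\<lambda>i. (?E i (\<lambda>q. \<tau> i * ?\<rho> i q * ?w (X i q)) -
      (?E i (\<lambda>q. \<tau> i * ?\<rho> i q * ?w (X i q)) -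
      ?E i (\<lambda>q. v (X i q) * stationary_queue.net_square (A i) (S i) q) / 2) -
      ?E i (\<lambda>q. v (X i q) * (stationary_queue.net_square (A i) (S i) q - 2 * c)) / 2) / c) \<longlongrightarrow>
      (0 - 0 - 0 / 2) / c) F"
      by (intro tendsto_intros drift_part generator_part variance_part) (use c in auto)
    moreover have "\<forall>\<^sub>F i in F. (?E i (\<lambda>q. \<tau> i * ?\<rho> i q * ?w (X i q)) -
      (?E i (\<lambda>q. \<tau> i * ?\<rho> i q * ?w (X i q)) -
      ?E i (\<lambda>q. v (X i q) * stationary_queue.net_square (A i) (S i) q) / 2) -
      ?E i (\<lambda>q. v (X i q) * (stationary_queue.net_square (A i) (S i) q - 2 * c)) / 2) / c = ?E i (\<lambda>q. v (X i q))"
      using queue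
    proof eventually_elim
      case (elim i)
      interpret stationary_queue "A i" "S i" "\<pi> i" M by (rule elim)
      have iv: "integrable (measure_pmf (\<pi> i)) (\<lambda>q. v (X i q))"
        by (rule integrable_pmf_bounded[OF L])
      have ivn: "integrable (measure_pmf (\<pi> i)) (\<lambda>q. v (X i q) * net_square q)"
      proof (rule integrable_pmf_bounded)
        fix q show "\<bar>v (X i q) * net_square q\<bar> \<le> L * M\<^sup>2"
          unfolding abs_mult using L L0 net_square_bound[of q] by (intro mult_mono) auto
      qed
      show ?case using iv ivn c by (simp add: right_diff_distrib field_simps)
    qed
    ultimately show ?thesis using Lim_transform_eventually by fastforce
  qed
  have remainder: "((\<lambda>i. ?E i (\<lambda>q. 1 * (h (X i q) - m - v (X i q)))) \<longlongrightarrow> 0) F"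
  proof (rule vanishing_expectation[where C=1 and t=t and W="L + L" and f="\<lambda>x. h x - m - v x"])
    show "\<bar>h x - m - v x\<bar> \<le> L + L" for x
      using L[of x] h(2)[of x] unfolding L_def by linarith
    show "\<exists>d>0. \<forall>x. 0 \<le> x \<longrightarrow> x < t + d \<longrightarrow> \<bar>h x - m - v x\<bar> \<le> e" if e: "0 < e" for e
    proof -
      have "continuous (at t) (\<lambda>x. h x - m - v x)"
        using continuous_on_diff[OF continuous_on_diff[OF h(1) continuous_on_const] v_cont]
        by (simp add: continuous_on_eq_continuous_at)
      moreover have "h t - m - v t = 0" by (simp add: v_def)
      ultimately obtain d where d: "0 < d" "\<And>x. dist x t < d \<Longrightarrow> \<bar>h x - m - v x\<bar> < e"
        using e unfolding continuous_at_eps_delta by (metis dist_0_norm dist_commute real_norm_def)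
      show ?thesis
      proof (intro exI conjI allI impI)
        fix x :: real assume "0 \<le> x" "x < t + d"
        then show "\<bar>h x - m - v x\<bar> \<le> e"
          using d(2)[of x] e by (cases "x \<le> t") (auto simp: v_def dist_real_def)
      qed (rule d)
    qed
  qed (use X0 X_tail in auto)
  have "((\<lambda>i. ?E i (\<lambda>q. 1 * (h (X i q) - m - v (X i q))) + ?E i (\<lambda>q. v (X i q)) + m) \<longlongrightarrow> 0 + 0 + m) F"
    by (intro tendsto_intros remainder v_mean)
  moreover have "?E i (\<lambda>q. 1 * (h (X i q) - m - v (X i q))) + ?E i (\<lambda>q. v (X i q)) + m = ?E i (\<lambda>q. h (X i q))" for i
  proof -
    have "integrable (measure_pmf (\<pi> i)) (\<lambda>q. v (X i q))" "integrable (measure_pmf (\<pi> i)) (\<lambda>q. h (X i q))"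
      by (rule integrable_pmf_bounded, rule L h)+
    then show ?thesis by simp
  qed
  ultimately show ?thesis by (simp add: X_def m_def)
qed

section \<open>The three regimes\<close>

lemma weak_conv_filter_at_topI:
  fixes M :: "real \<Rightarrow> real measure"
  assumes M: "\<And>\<eta>. real_distribution (M \<eta>)" and N: "real_distribution N"
    and lim: "\<And>a b. a < b \<Longrightarrow>
      ((\<lambda>\<eta>. integral\<^sup>L (M \<eta>) (cts_step a b)) \<longlongrightarrow> integral\<^sup>L N (cts_step a b)) at_top"
  shows "weak_conv_filter M N at_top"
  unfolding weak_conv_filter_def
proof (intro allI impI tendsto_at_topI_sequentially)
  fix x and \<eta> :: "nat \<Rightarrow> real" assume x: "isCont (cdf N) x" and \<eta>: "filterlim \<eta> at_top sequentially"
  have "weak_conv_m (\<lambda>n. M (\<eta> n)) N"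
    by (rule integral_cts_step_conv_imp_weak_conv[OF M N]) (rule filterlim_compose[OF lim \<eta>])
  then show "(\<lambda>n. cdf (M (\<eta> n)) x) \<longlonglongrightarrow> cdf N x"
    using x by (auto simp: weak_conv_m_def weak_conv_def)
qed

text \<open>
  The continuous approximations of indicators of half-lines used in the proof for sequences are
  uniformly continuous and bounded by one, so convergence of the means of such functions is enough.
\<close>
lemma weak_conv_filter_pmf_at_topI:
  fixes p :: "real \<Rightarrow> nat pmf" and X :: "real \<Rightarrow> nat \<Rightarrow> real"
  assumes N: "real_distribution N"
    and lim: "\<And>h :: real \<Rightarrow> real. uniformly_continuous_on UNIV h \<Longrightarrow> (\<And>x. \<bar>h x\<bar> \<le> 1) \<Longrightarrow>
      ((\<lambda>\<eta>. measure_pmf.expectation (p \<eta>) (\<lambda>q. h (X \<eta> q))) \<longlongrightarrow> integral\<^sup>L N h) at_top"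
  shows "weak_conv_filter (\<lambda>\<eta>. distr (measure_pmf (p \<eta>)) borel (X \<eta>)) N at_top"
proof (rule weak_conv_filter_at_topI[OF _ N])
  show "real_distribution (distr (measure_pmf (p \<eta>)) borel (X \<eta>))" for \<eta>
    by (rule prob_space.real_distribution_distr[OF prob_space_measure_pmf]) simp
  fix a b :: real assume ab: "a < b"
  have "cts_step a b \<in> borel_measurable borel"
    using cts_step_uniformly_continuous[OF ab]
    by (intro borel_measurable_continuous_onI uniformly_continuous_imp_continuous)
  then have "integral\<^sup>L (distr (measure_pmf (p \<eta>)) borel (X \<eta>)) (cts_step a b) =
      measure_pmf.expectation (p \<eta>) (\<lambda>q. cts_step a b (X \<eta> q))" for \<eta>
    by (intro integral_distr) auto
  moreover have "\<bar>cts_step a b x\<bar> \<le> 1" for x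
    using ab by (auto simp: cts_step_def)
  ultimately show "((\<lambda>\<eta>. integral\<^sup>L (distr (measure_pmf (p \<eta>)) borel (X \<eta>)) (cts_step a b)) \<longlongrightarrow>
      integral\<^sup>L N (cts_step a b)) at_top"
    using lim[OF cts_step_uniformly_continuous[OF ab]] by simp
qed

lemma infinitely_differentiable_imp_continuous:
  assumes "infinitely_differentiable f"
  shows "continuous_on UNIV f"
proof -
  have "f differentiable (at x)" for x
    using assms[unfolded infinitely_differentiable_def, rule_format, of 0 x] by simp
  then show ?thesis
    by (simp add: continuous_on_eq_continuous_at differentiable_imp_continuous_within)
qed

theorem theorem4:
  fixes \<epsilon> \<tau> :: "real \<Rightarrow> real"
    and A S :: "real \<Rightarrow> nat \<Rightarrow> nat pmf"
    and lam mu :: "real \<Rightarrow> nat \<Rightarrow> real"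
    and lam_star mu_star :: real
    and \<phi>c \<phi>s \<sigma>c \<sigma>s :: "real \<Rightarrow> real"
    and \<phi>c_inf \<phi>s_inf A_max \<sigma>_max \<phi>_max \<delta> K :: real
    and \<pi> :: "real \<Rightarrow> nat pmf"
  assumes pos: "\<And>\<eta>. \<eta> > 0 \<Longrightarrow> \<epsilon> \<eta> > 0" "\<And>\<eta>. \<eta> > 0 \<Longrightarrow> \<tau> \<eta> > 0"
    and lam: "\<And>\<eta> q. \<eta> > 0 \<Longrightarrow> lam \<eta> q = lam_star + \<epsilon> \<eta> * \<phi>c (real q / \<tau> \<eta>)"
    and mu: "\<And>\<eta> q. \<eta> > 0 \<Longrightarrow> mu \<eta> q = mu_star + \<epsilon> \<eta> * \<phi>s (real q / \<tau> \<eta>)"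
    and arrival_mean: "\<And>\<eta> q. \<eta> > 0 \<Longrightarrow> measure_pmf.expectation (A \<eta> q) real = lam \<eta> q"
    and arrival_var: "\<And>\<eta> q. \<eta> > 0 \<Longrightarrow> measure_pmf.variance (A \<eta> q) real = \<sigma>c (lam \<eta> q)"
    and service_mean: "\<And>\<eta> q. \<eta> > 0 \<Longrightarrow> measure_pmf.expectation (S \<eta> q) real = mu \<eta> q"
    and service_var: "\<And>\<eta> q. \<eta> > 0 \<Longrightarrow> measure_pmf.variance (S \<eta> q) real = \<sigma>s (mu \<eta> q)"
    and \<phi>_measurable: "\<phi>c \<in> borel_measurable borel" "\<phi>s \<in> borel_measurable borel"
    and \<sigma>_continuous: "continuous_on UNIV \<sigma>c" "continuous_on UNIV \<sigma>s"
    and balanced: "lam_star = mu_star"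
    and \<phi>_limits: "(\<phi>c \<longlongrightarrow> \<phi>c_inf) at_top" "(\<phi>s \<longlongrightarrow> \<phi>s_inf) at_top" "\<phi>s_inf - \<phi>c_inf = 1"
    and bounds_pos: "A_max > 0" "\<sigma>_max > 0" "\<phi>_max > 0"
    and arrival_bound: "\<And>\<eta> q. \<eta> > 0 \<Longrightarrow> AE a in measure_pmf (A \<eta> q). real a \<le> A_max"
    and service_bound: "\<And>\<eta> q. \<eta> > 0 \<Longrightarrow> AE s in measure_pmf (S \<eta> q). real s \<le> A_max"
    and \<sigma>_bound: "\<And>\<eta> q. \<eta> > 0 \<Longrightarrow> \<sigma>c (lam \<eta> q) \<le> \<sigma>_max"
      "\<And>\<eta> q. \<eta> > 0 \<Longrightarrow> \<sigma>s (mu \<eta> q) \<le> \<sigma>_max"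
    and \<phi>_bound: "\<And>x. \<bar>\<phi>c x\<bar> \<le> \<phi>_max" "\<And>x. \<bar>\<phi>s x\<bar> \<le> \<phi>_max"
    and irreducible: "\<And>\<eta>. \<eta> > 0 \<Longrightarrow> irreducible_kernel (queue_kernel (A \<eta>) (S \<eta>))"
    and aperiodic: "\<And>\<eta>. \<eta> > 0 \<Longrightarrow> aperiodic_kernel (queue_kernel (A \<eta>) (S \<eta>))"
    and \<sigma>_nondegenerate: "\<sigma>c lam_star + \<sigma>s mu_star > 0"
    and regime: "(\<epsilon> \<longlongrightarrow> 0) at_top \<or> filterlim \<tau> at_top at_top"
    and drift: "\<delta> > 0" "K > 0" "\<And>x. x > K \<Longrightarrow> \<phi>c x - \<phi>s x < - \<delta>"
    and recurrent: "\<And>\<eta>. \<eta> > 0 \<Longrightarrow> positive_recurrent (queue_kernel (A \<eta>) (S \<eta>))"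
    and steady_state:
      "\<And>\<eta>. \<eta> > 0 \<Longrightarrow> stationary_distribution (queue_kernel (A \<eta>) (S \<eta>)) (\<pi> \<eta>)"
  shows
    "(((\<lambda>\<eta>. \<epsilon> \<eta> * \<tau> \<eta>) \<longlongrightarrow> 0) at_top \<longrightarrow>
       weak_conv_filter (\<lambda>\<eta>. distr (measure_pmf (\<pi> \<eta>)) borel (\<lambda>q. \<epsilon> \<eta> * real q))
         (exponential_law (2 / (\<sigma>c lam_star + \<sigma>s mu_star))) at_top)
     \<and>
     (\<forall>l>0. ((\<lambda>\<eta>. \<epsilon> \<eta> * \<tau> \<eta>) \<longlongrightarrow> l) at_top \<and>
         infinitely_differentiable \<phi>c \<and> infinitely_differentiable \<phi>s \<longrightarrow>
       weak_conv_filter (\<lambda>\<eta>. distr (measure_pmf (\<pi> \<eta>)) borel (\<lambda>q. \<epsilon> \<eta> * real q))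
         (gibbs_law (\<lambda>t. 2 / (\<sigma>c lam_star + \<sigma>s mu_star) * (\<phi>s (t / l) - \<phi>c (t / l)))) at_top)
     \<and>
     (\<forall>t_star>0. filterlim (\<lambda>\<eta>. \<epsilon> \<eta> * \<tau> \<eta>) at_top at_top \<and>
         antimono \<phi>c \<and> mono \<phi>s \<and>
         {x. \<phi>c x - \<phi>s x = 0} = {0..t_star} \<and>
         (\<forall>x\<in>{x. \<phi>c x - \<phi>s x = 0}. \<phi>c x = 0 \<and> \<phi>s x = 0) \<longrightarrow>
       weak_conv_filter (\<lambda>\<eta>. distr (measure_pmf (\<pi> \<eta>)) borel (\<lambda>q. real q / \<tau> \<eta>))
         (uniform_measure lborel {0..t_star}) at_top)"
proof -
  define \<psi> where "\<psi> = (\<lambda>x. \<phi>s x - \<phi>c x)"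
  define c where "c = (\<sigma>c lam_star + \<sigma>s mu_star) / 2"
  have c: "0 < c" using \<sigma>_nondegenerate by (simp add: c_def)
  have \<psi>_lim: "(\<psi> \<longlongrightarrow> 1) at_top"
    using tendsto_diff[OF \<phi>_limits(2,1)] \<phi>_limits(3) by (simp add: \<psi>_def)
  have \<psi>_bound: "\<bar>\<psi> x\<bar> \<le> 2 * \<phi>_max" for x
    using \<phi>_bound(1)[of x] \<phi>_bound(2)[of x] by (simp add: \<psi>_def)
  have \<psi>_drift: "\<delta> < \<psi> x" if "K < x" for x
    using drift(3)[OF that] by (simp add: \<psi>_def)
  have queue: "stationary_queue (A \<eta>) (S \<eta>) (\<pi> \<eta>) A_max" if "0 < \<eta>" for \<eta>
    using arrival_bound[OF that] service_bound[OF that] steady_state[OF that]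
    by (simp add: stationary_queue_def AE_measure_pmf_iff)
  have surplus: "stationary_queue.service_surplus (A \<eta>) (S \<eta>) q = \<epsilon> \<eta> * \<psi> (real q / \<tau> \<eta>)" if "0 < \<eta>" for \<eta> q
    by (simp add: stationary_queue.service_surplus_def[OF queue[OF that]] arrival_mean[OF that]
        service_mean[OF that] lam[OF that] mu[OF that] balanced \<psi>_def algebra_simps)
  have net_square: "stationary_queue.net_square (A \<eta>) (S \<eta>) q =
      \<sigma>c (lam \<eta> q) + \<sigma>s (mu \<eta> q) + (\<epsilon> \<eta> * \<psi> (real q / \<tau> \<eta>))\<^sup>2" if "0 < \<eta>" for \<eta> q
    using stationary_queue.net_square_eq[OF queue[OF that], of q]
    by (simp only: arrival_var[OF that] service_var[OF that] surplus[OF that])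
  have integrable: "integrable (measure_pmf (\<pi> \<eta>)) real" if \<eta>: "0 < \<eta>" for \<eta>
  proof (rule stationary_queue.integrable_queue[OF queue[OF \<eta>]])
    show "0 < \<epsilon> \<eta> * \<delta>" using pos[OF \<eta>] drift by simp
    fix q assume "(K + 1) * \<tau> \<eta> \<le> real q"
    \<comment> \<open>At or beyond \<open>K + 1\<close>, rather than \<open>K\<close>, because the drift condition is strict.\<close>
    then have "K < real q / \<tau> \<eta>" using pos(2)[OF \<eta>] by (simp add: pos_less_divide_eq algebra_simps)
    from \<psi>_drift[OF this] show "\<epsilon> \<eta> * \<delta> \<le> stationary_queue.service_surplus (A \<eta>) (S \<eta>) q"
      using pos(1)[OF \<eta>] by (simp add: surplus[OF \<eta>])
  qed
  \<comment> \<open>The error in the conditional second moment depends only on the distance of the two means from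
    their common limit. Stated in this form it serves the regimes with \<open>\<epsilon> \<longlonglongrightarrow> 0\<close> and the third one.\<close>
  have noise: "\<exists>\<kappa>>0. \<forall>\<eta>>0. \<forall>q. \<bar>\<epsilon> \<eta> * \<phi>c (real q / \<tau> \<eta>)\<bar> < \<kappa> \<longrightarrow> \<bar>\<epsilon> \<eta> * \<phi>s (real q / \<tau> \<eta>)\<bar> < \<kappa> \<longrightarrow>
      \<bar>stationary_queue.net_square (A \<eta>) (S \<eta>) q - 2 * c\<bar> \<le> e" if e: "0 < e" for e :: real
  proof -
    have "isCont \<sigma>c lam_star" "isCont \<sigma>s mu_star"
      using \<sigma>_continuous by (auto simp: continuous_on_eq_continuous_at)
    then obtain d1 d2 where d1: "0 < d1" "\<And>x. \<bar>x - lam_star\<bar> < d1 \<Longrightarrow> \<bar>\<sigma>c x - \<sigma>c lam_star\<bar> < e / 3"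
      and d2: "0 < d2" "\<And>x. \<bar>x - mu_star\<bar> < d2 \<Longrightarrow> \<bar>\<sigma>s x - \<sigma>s mu_star\<bar> < e / 3"
      using e unfolding continuous_at_eps_delta dist_real_def by (metis divide_pos_pos zero_less_numeral)
    define \<kappa> where "\<kappa> = min (min d1 d2) (min (1 / 2) (e / 6))"
    have "0 < \<kappa>" using d1 d2 e by (simp add: \<kappa>_def)
    moreover have "\<bar>stationary_queue.net_square (A \<eta>) (S \<eta>) q - 2 * c\<bar> \<le> e"
      if \<eta>: "0 < \<eta>" and "\<bar>\<epsilon> \<eta> * \<phi>c (real q / \<tau> \<eta>)\<bar> < \<kappa>" "\<bar>\<epsilon> \<eta> * \<phi>s (real q / \<tau> \<eta>)\<bar> < \<kappa>" for \<eta> q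
    proof -
      let ?z = "\<epsilon> \<eta> * \<psi> (real q / \<tau> \<eta>)"
      have "\<bar>?z\<bar> \<le> 2 * \<kappa>" using that by (simp add: \<psi>_def right_diff_distrib)
      then have z: "\<bar>?z\<bar> \<le> 1" "\<bar>?z\<bar> \<le> e / 3" by (auto simp: \<kappa>_def)
      have "?z\<^sup>2 = \<bar>?z\<bar> * \<bar>?z\<bar>" by (simp add: power2_eq_square)
      also have "\<dots> \<le> 1 * (e / 3)" using z by (intro mult_mono) auto
      finally have "?z\<^sup>2 \<le> e / 3" by simp
      moreover have "\<bar>\<sigma>c (lam \<eta> q) - \<sigma>c lam_star\<bar> < e / 3" "\<bar>\<sigma>s (mu \<eta> q) - \<sigma>s mu_star\<bar> < e / 3"
        using that by (intro d1(2) d2(2); simp add: lam[OF \<eta>] mu[OF \<eta>] \<kappa>_def)+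
      moreover have "2 * c = \<sigma>c lam_star + \<sigma>s mu_star" by (simp add: c_def)
      ultimately show ?thesis
        unfolding net_square[OF \<eta>] abs_le_iff abs_less_iff using zero_le_power2[of ?z]
        by (intro conjI; linarith)
    qed
    ultimately show ?thesis by blast
  qed
  have ev: "\<forall>\<^sub>F \<eta> in at_top. P \<eta>" if "\<And>\<eta>::real. 0 < \<eta> \<Longrightarrow> P \<eta>" for P
    using eventually_gt_at_top[of 0] by eventually_elim (rule that)
  \<comment> \<open>If \<open>\<tau>\<close> tends to infinity and \<open>\<epsilon> * \<tau>\<close> converges, then \<open>\<epsilon>\<close> tends to zero.\<close>
  have \<epsilon>_tendsto: "(\<epsilon> \<longlongrightarrow> 0) at_top" if "((\<lambda>\<eta>. \<epsilon> \<eta> * \<tau> \<eta>) \<longlongrightarrow> l) at_top" for l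
    using regime
  proof
    assume "filterlim \<tau> at_top at_top"
    from tendsto_mult[OF that tendsto_inverse_0_at_top[OF this]]
    have "((\<lambda>\<eta>. \<epsilon> \<eta> * \<tau> \<eta> * inverse (\<tau> \<eta>)) \<longlongrightarrow> 0) at_top" by simp
    moreover have "\<forall>\<^sub>F \<eta> in at_top. \<epsilon> \<eta> * \<tau> \<eta> * inverse (\<tau> \<eta>) = \<epsilon> \<eta>"
      by (rule ev) (use pos in \<open>force simp: field_simps\<close>)
    ultimately show ?thesis by (rule Lim_transform_eventually)
  qed
  have noise_vanishing: "\<forall>\<^sub>F \<eta> in at_top. \<forall>q. \<bar>stationary_queue.net_square (A \<eta>) (S \<eta>) q - 2 * c\<bar> \<le> e"
    if \<epsilon>0: "(\<epsilon> \<longlongrightarrow> 0) at_top" and e: "0 < e" for e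
  proof -
    obtain \<kappa> where \<kappa>: "0 < \<kappa>" and ns: "\<And>\<eta> q. 0 < \<eta> \<Longrightarrow> \<bar>\<epsilon> \<eta> * \<phi>c (real q / \<tau> \<eta>)\<bar> < \<kappa> \<Longrightarrow>
      \<bar>\<epsilon> \<eta> * \<phi>s (real q / \<tau> \<eta>)\<bar> < \<kappa> \<Longrightarrow> \<bar>stationary_queue.net_square (A \<eta>) (S \<eta>) q - 2 * c\<bar> \<le> e"
      using noise[OF e] by blast
    have "((\<lambda>\<eta>. \<epsilon> \<eta> * \<phi>_max) \<longlongrightarrow> 0) at_top" using tendsto_mult_left_zero[OF \<epsilon>0] .
    from order_tendstoD(2)[OF this \<kappa>] eventually_gt_at_top[of 0] show ?thesis
    proof eventually_elim
      case (elim \<eta>)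
      have "\<epsilon> \<eta> * \<bar>\<phi>c x\<bar> < \<kappa>" "\<epsilon> \<eta> * \<bar>\<phi>s x\<bar> < \<kappa>" for x
        using mult_left_mono[OF \<phi>_bound(1)[of x] less_imp_le[OF pos(1)[OF elim(2)]]]
          mult_left_mono[OF \<phi>_bound(2)[of x] less_imp_le[OF pos(1)[OF elim(2)]]] elim(1) by linarith+
      then show ?case using ns[OF elim(2)] pos(1)[OF elim(2)] by (simp add: abs_mult)
    qed
  qed
  have ev_queue: "\<forall>\<^sub>F \<eta> in at_top. stationary_queue (A \<eta>) (S \<eta>) (\<pi> \<eta>) A_max"
    by (rule ev) (rule queue)
  have ev_integrable: "\<forall>\<^sub>F \<eta> in at_top. integrable (measure_pmf (\<pi> \<eta>)) real"
    by (rule ev) (rule integrable)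
  have ev_pos: "\<forall>\<^sub>F \<eta> in at_top. 0 < \<epsilon> \<eta>"
    by (rule ev) (rule pos(1))
  have ev_surplus: "\<forall>\<^sub>F \<eta> in at_top. \<forall>q. stationary_queue.service_surplus (A \<eta>) (S \<eta>) q =
      \<epsilon> \<eta> * \<psi> (real q / \<tau> \<eta>)"
    by (rule ev) (simp add: surplus)
  have ev_surplus_rescaled: "\<forall>\<^sub>F \<eta> in at_top. \<forall>q. stationary_queue.service_surplus (A \<eta>) (S \<eta>) q =
      \<epsilon> \<eta> * \<psi> (\<epsilon> \<eta> * real q / (\<epsilon> \<eta> * \<tau> \<eta>))"
  proof (rule ev)
    fix \<eta> :: real assume \<eta>: "0 < \<eta>"
    then show "\<forall>q. stationary_queue.service_surplus (A \<eta>) (S \<eta>) q =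
        \<epsilon> \<eta> * \<psi> (\<epsilon> \<eta> * real q / (\<epsilon> \<eta> * \<tau> \<eta>))"
      using pos[OF \<eta>] by (simp add: surplus)
  qed

  have part1: "weak_conv_filter (\<lambda>\<eta>. distr (measure_pmf (\<pi> \<eta>)) borel (\<lambda>q. \<epsilon> \<eta> * real q))
      (exponential_law (2 / (\<sigma>c lam_star + \<sigma>s mu_star))) at_top"
    if \<kappa>: "((\<lambda>\<eta>. \<epsilon> \<eta> * \<tau> \<eta>) \<longlongrightarrow> 0) at_top"
  proof -
    have law: "exponential_law (2 / (\<sigma>c lam_star + \<sigma>s mu_star)) = gibbs_law (\<lambda>_. 1 / c)"
      using exponential_law_eq_gibbs_law[of "1 / c"] c by (simp add: c_def)
    interpret gibbs_potential "\<lambda>_. 1 / c" "1 / c" "1 / c" 0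
      by unfold_locales (use c in auto)
    show ?thesis unfolding law
    proof (rule weak_conv_filter_pmf_at_topI[OF real_distribution_gibbs])
      fix h :: "real \<Rightarrow> real" assume h: "uniformly_continuous_on UNIV h" "\<And>x. \<bar>h x\<bar> \<le> 1"
      show "((\<lambda>\<eta>. measure_pmf.expectation (\<pi> \<eta>) (\<lambda>q. h (\<epsilon> \<eta> * real q))) \<longlongrightarrow>
          integral\<^sup>L (gibbs_law (\<lambda>_. 1 / c)) h) at_top"
      proof (rule queue_gibbs_limit[where b="\<lambda>_. 1" and b'="\<lambda>\<eta> x. \<psi> (x / (\<epsilon> \<eta> * \<tau> \<eta>))" and
            B="2 * \<phi>_max + 1" and \<beta>=1 and K=0 and c=c and H=1,
            OF ev_queue ev_integrable ev_pos \<epsilon>_tendsto[OF \<kappa>] ev_surplus_rescaled])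
        show "\<forall>\<^sub>F \<eta> in at_top. \<forall>x\<ge>0. min 1 x * \<bar>\<psi> (x / (\<epsilon> \<eta> * \<tau> \<eta>)) - 1\<bar> \<le> e" if e: "0 < e" for e
        proof -
          define B where "B = 2 * \<phi>_max + 1"
          have B: "0 < B" "\<bar>\<psi> x - 1\<bar> \<le> B" for x using \<psi>_bound[of x] bounds_pos by (auto simp: B_def)
          obtain R where R: "\<And>x. R \<le> x \<Longrightarrow> \<bar>\<psi> x - 1\<bar> < e"
            using tendstoD[OF \<psi>_lim e] by (auto simp: eventually_at_top_linorder dist_real_def)
          \<comment> \<open>For \<open>x \<le> d\<close> the factor \<open>min 1 x\<close> is small; for \<open>x > d\<close> the argument \<open>x / (\<epsilon> * \<tau>)\<close> is large.\<close>
          define d where "d = e / B"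
          have d: "0 < d" using e B by (simp add: d_def)
          have "0 < d / (\<bar>R\<bar> + 1)" using d by simp
          from order_tendstoD(2)[OF \<kappa> this] eventually_gt_at_top[of 0] show ?thesis
          proof eventually_elim
            case (elim \<eta>)
            define k where "k = \<epsilon> \<eta> * \<tau> \<eta>"
            have k: "0 < k" "k * (\<bar>R\<bar> + 1) < d"
              using elim pos[OF elim(2)] by (simp_all add: k_def pos_less_divide_eq add_nonneg_pos)
            show ?case unfolding k_def[symmetric]
            proof (intro allI impI)
              fix x :: real assume x: "0 \<le> x"
              show "min 1 x * \<bar>\<psi> (x / k) - 1\<bar> \<le> e"
              proof (cases "x \<le> d")
                case True
                then have "min 1 x * \<bar>\<psi> (x / k) - 1\<bar> \<le> d * B" using B x by (intro mult_mono) auto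
                then show ?thesis using B by (simp add: d_def)
              next
                case False
                have "R * k \<le> k * (\<bar>R\<bar> + 1)" using k by (simp add: mult.commute)
                then have "R * k \<le> x" using k False by linarith
                then have "R \<le> x / k" using k by (simp add: pos_le_divide_eq)
                then have "min 1 x * \<bar>\<psi> (x / k) - 1\<bar> \<le> 1 * e" using R[of "x / k"] x by (intro mult_mono) auto
                then show ?thesis by simp
              qed
            qed
          qed
        qed
        have "\<bar>\<psi> x\<bar> \<le> 2 * \<phi>_max + 1" for x using \<psi>_bound[of x] by simp
        then show "\<forall>\<^sub>F \<eta> in at_top. \<forall>x\<ge>0. \<bar>\<psi> (x / (\<epsilon> \<eta> * \<tau> \<eta>))\<bar> \<le> 2 * \<phi>_max + 1" by simp
      qed (use noise_vanishing[OF \<epsilon>_tendsto[OF \<kappa>]] c h bounds_pos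
           in \<open>simp_all add: uniformly_continuous_on_const\<close>)
    qed
  qed

  have part2: "weak_conv_filter (\<lambda>\<eta>. distr (measure_pmf (\<pi> \<eta>)) borel (\<lambda>q. \<epsilon> \<eta> * real q))
      (gibbs_law (\<lambda>t. 2 / (\<sigma>c lam_star + \<sigma>s mu_star) * (\<phi>s (t / l) - \<phi>c (t / l)))) at_top"
    if l: "0 < l" and \<kappa>: "((\<lambda>\<eta>. \<epsilon> \<eta> * \<tau> \<eta>) \<longlongrightarrow> l) at_top"
      and smooth: "infinitely_differentiable \<phi>c" "infinitely_differentiable \<phi>s" for l
  proof -
    have law: "(\<lambda>t. 2 / (\<sigma>c lam_star + \<sigma>s mu_star) * (\<phi>s (t / l) - \<phi>c (t / l))) = (\<lambda>t. \<psi> (t / l) / c)"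
      by (simp add: \<psi>_def c_def fun_eq_iff)
    have \<psi>_cont: "continuous_on T \<psi>" for T
      unfolding \<psi>_def using smooth
      by (intro continuous_on_diff continuous_on_subset[OF infinitely_differentiable_imp_continuous]) auto
    have \<psi>_uc: "uniformly_continuous_on {0..} \<psi>"
      by (rule uniformly_continuous_on_half_line[OF \<psi>_cont \<psi>_lim])
    have b_uc: "uniformly_continuous_on {0..} (\<lambda>x. \<psi> (x / l))"
    proof (rule uniformly_continuous_on_half_line)
      show "continuous_on {0..} (\<lambda>x. \<psi> (x / l))"
        using l by (intro continuous_on_compose2[OF \<psi>_cont[of UNIV]] continuous_intros) auto
      have "filterlim (\<lambda>x. x / l) at_top at_top" using l by real_asymp
      then show "((\<lambda>x. \<psi> (x / l)) \<longlongrightarrow> 1) at_top" by (rule filterlim_compose[OF \<psi>_lim])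
    qed
    have b_drift: "\<delta> \<le> \<psi> (x / l)" if "K * l < x" for x
      using \<psi>_drift[of "x / l"] that l by (simp add: pos_less_divide_eq)
    interpret gibbs_potential "\<lambda>x. \<psi> (x / l) / c" "2 * \<phi>_max / c" "\<delta> / c" "K * l"
      using c l drift \<psi>_bound b_drift uniformly_continuous_imp_continuous[OF b_uc]
      by unfold_locales (auto intro!: continuous_intros divide_right_mono)
    show ?thesis unfolding law
    proof (rule weak_conv_filter_pmf_at_topI[OF real_distribution_gibbs])
      fix h :: "real \<Rightarrow> real" assume h: "uniformly_continuous_on UNIV h" "\<And>x. \<bar>h x\<bar> \<le> 1"
      show "((\<lambda>\<eta>. measure_pmf.expectation (\<pi> \<eta>) (\<lambda>q. h (\<epsilon> \<eta> * real q))) \<longlongrightarrow>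
          integral\<^sup>L (gibbs_law (\<lambda>x. \<psi> (x / l) / c)) h) at_top"
      proof (rule queue_gibbs_limit[where b="\<lambda>x. \<psi> (x / l)" and b'="\<lambda>\<eta> x. \<psi> (x / (\<epsilon> \<eta> * \<tau> \<eta>))" and
            B="2 * \<phi>_max" and \<beta>=\<delta> and K="K * l" and c=c and H=1,
            OF ev_queue ev_integrable ev_pos \<epsilon>_tendsto[OF \<kappa>] ev_surplus_rescaled])
        show "\<forall>\<^sub>F \<eta> in at_top. \<forall>x\<ge>0. min 1 x * \<bar>\<psi> (x / (\<epsilon> \<eta> * \<tau> \<eta>)) - \<psi> (x / l)\<bar> \<le> e" if e: "0 < e" for e
        proof -
          obtain R0 where R0: "\<And>x. R0 \<le> x \<Longrightarrow> \<bar>\<psi> x - 1\<bar> < e / 2"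
            using tendstoD[OF \<psi>_lim, of "e / 2"] e by (auto simp: eventually_at_top_linorder dist_real_def)
          define R where "R = \<bar>R0\<bar> + 1"
          have R: "0 < R" "\<bar>\<psi> x - 1\<bar> < e / 2" if "R \<le> x" for x using R0[of x] that by (auto simp: R_def)
          have R_pos: "0 < R" by (simp add: R_def add_nonneg_pos)
          obtain d where d: "0 < d" "\<And>x y. 0 \<le> x \<Longrightarrow> 0 \<le> y \<Longrightarrow> dist y x < d \<Longrightarrow> dist (\<psi> y) (\<psi> x) < e"
            using \<psi>_uc e unfolding uniformly_continuous_on_def by (metis atLeast_iff)
          have "((\<lambda>\<eta>. l / (\<epsilon> \<eta> * \<tau> \<eta>)) \<longlongrightarrow> l / l) at_top" using \<kappa> l by (intro tendsto_intros) auto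
          then have ratio: "((\<lambda>\<eta>. l / (\<epsilon> \<eta> * \<tau> \<eta>)) \<longlongrightarrow> 1) at_top" using l by simp
          have "0 < min (1 / 2) (d / (2 * R))" using d R_pos by simp
          from tendstoD[OF ratio this] eventually_gt_at_top[of 0] show ?thesis
          proof eventually_elim
            case (elim \<eta>)
            \<comment> \<open>The argument \<open>x / (\<epsilon> * \<tau>)\<close> is the argument \<open>u = x / l\<close> times a ratio \<open>s\<close> close to \<open>1\<close>: for
              moderate \<open>u\<close> uniform continuity applies, for large \<open>u\<close> both values are close to the limit at infinity.\<close>
            define s where "s = l / (\<epsilon> \<eta> * \<tau> \<eta>)"
            have s: "\<bar>s - 1\<bar> < 1 / 2" "2 * R * \<bar>s - 1\<bar> < d"
              using elim(1) R_pos by (auto simp: s_def dist_real_def field_simps)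
            show ?case
            proof (intro allI impI)
              fix x :: real assume x: "0 \<le> x"
              define u where "u = x / l"
              have u: "0 \<le> u" using x l by (simp add: u_def)
              have xs: "x / (\<epsilon> \<eta> * \<tau> \<eta>) = u * s" using l by (simp add: u_def s_def)
              have s_half: "1 / 2 \<le> s" using s(1) by linarith
              have "\<bar>\<psi> (u * s) - \<psi> u\<bar> \<le> e"
              proof (cases "u \<le> 2 * R")
                case True
                have "\<bar>u * s - u\<bar> = \<bar>u * (s - 1)\<bar>" by (simp add: right_diff_distrib)
                also have "\<dots> = u * \<bar>s - 1\<bar>" using u by (simp add: abs_mult)
                also have "\<dots> \<le> 2 * R * \<bar>s - 1\<bar>" using True by (intro mult_right_mono) auto
                finally have "dist (u * s) u < d" using s by (simp add: dist_real_def)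
                then have "dist (\<psi> (u * s)) (\<psi> u) < e" using u s_half by (intro d(2)) auto
                then show ?thesis by (simp add: dist_real_def)
              next
                case False
                have "2 * R * (1 / 2) \<le> u * s" using False u s_half by (intro mult_mono) auto
                then have "R \<le> u * s" "R \<le> u" using False R_pos by auto
                then show ?thesis using R(2)[of u] R(2)[of "u * s"] by linarith
              qed
              then have "min 1 x * \<bar>\<psi> (u * s) - \<psi> u\<bar> \<le> 1 * e" using x by (intro mult_mono) auto
              then show "min 1 x * \<bar>\<psi> (x / (\<epsilon> \<eta> * \<tau> \<eta>)) - \<psi> (x / l)\<bar> \<le> e"
                unfolding xs u_def[symmetric] by simp
            qed
          qed
        qed
        show "\<forall>\<^sub>F \<eta> in at_top. \<forall>x\<ge>0. \<bar>\<psi> (x / (\<epsilon> \<eta> * \<tau> \<eta>))\<bar> \<le> 2 * \<phi>_max"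
          using \<psi>_bound by simp
      qed (use noise_vanishing[OF \<epsilon>_tendsto[OF \<kappa>]] c h l drift(1,2) \<psi>_bound b_uc b_drift in simp_all)
    qed
  qed

  have part3: "weak_conv_filter (\<lambda>\<eta>. distr (measure_pmf (\<pi> \<eta>)) borel (\<lambda>q. real q / \<tau> \<eta>))
      (uniform_measure lborel {0..t_star}) at_top"
    if t: "0 < t_star" and \<kappa>: "filterlim (\<lambda>\<eta>. \<epsilon> \<eta> * \<tau> \<eta>) at_top at_top"
      and mono: "antimono \<phi>c" "mono \<phi>s" and zeros: "{x. \<phi>c x - \<phi>s x = 0} = {0..t_star}"
      and vanish: "\<forall>x\<in>{x. \<phi>c x - \<phi>s x = 0}. \<phi>c x = 0 \<and> \<phi>s x = 0" for t_star
  proof -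
    have vanish': "\<phi>c x = 0" "\<phi>s x = 0" "\<psi> x = 0" if "0 \<le> x" "x \<le> t_star" for x
      using vanish that unfolding zeros by (auto simp: \<psi>_def)
    have \<psi>_mono: "\<psi> x \<le> \<psi> y" if "x \<le> y" for x y
      using antimonoD[OF mono(1) that] monoD[OF mono(2) that] by (simp add: \<psi>_def)
    have \<psi>_pos: "0 < \<psi> x" if "t_star < x" for x
    proof -
      have "x \<notin> {x. \<phi>c x - \<phi>s x = 0}" unfolding zeros using that by simp
      then show ?thesis using \<psi>_mono[of t_star x] vanish'(3)[of t_star] that t by (simp add: \<psi>_def)
    qed
    \<comment> \<open>Monotonicity gives \<open>\<phi>c\<close> and \<open>\<phi>s\<close> opposite signs beyond \<open>t_star\<close>, so a small difference forces both
      to be small.\<close>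
    have dominated: "\<bar>\<phi>c x\<bar> \<le> \<psi> x" "\<bar>\<phi>s x\<bar> \<le> \<psi> x" if x: "0 \<le> x" for x
      using antimonoD[OF mono(1), of t_star x] monoD[OF mono(2), of t_star x]
        vanish'[of t_star] vanish'[OF x] t by (cases "x \<le> t_star"; simp add: \<psi>_def)+
    \<comment> \<open>Once \<open>\<epsilon> < 1\<close>, the product \<open>\<epsilon> * \<tau>\<close> is a lower bound for \<open>\<tau>\<close>.\<close>
    have \<tau>_top: "filterlim \<tau> at_top at_top"
      using regime
    proof
      assume "(\<epsilon> \<longlongrightarrow> 0) at_top"
      from order_tendstoD(2)[OF this, of 1] have "\<forall>\<^sub>F \<eta> in at_top. \<epsilon> \<eta> < 1" by simp
      then have "\<forall>\<^sub>F \<eta> in at_top. \<epsilon> \<eta> * \<tau> \<eta> \<le> \<tau> \<eta>"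
        using eventually_gt_at_top[of 0]
      proof eventually_elim
        case (elim \<eta>)
        show ?case
          using mult_right_mono[of "\<epsilon> \<eta>" 1 "\<tau> \<eta>"] elim(1) pos(2)[OF elim(2)] by simp
      qed
      then show ?thesis by (rule filterlim_at_top_mono[OF \<kappa>])
    qed
    have "prob_space (uniform_measure lborel {0..t_star})"
      using t by (intro prob_space_uniform_measure) auto
    then have "real_distribution (uniform_measure lborel {0..t_star})"
      by (auto simp: real_distribution_def real_distribution_axioms_def)
    then show ?thesis
    proof (rule weak_conv_filter_pmf_at_topI)
      fix h :: "real \<Rightarrow> real" assume h: "uniformly_continuous_on UNIV h" "\<And>x. \<bar>h x\<bar> \<le> 1"
      show "((\<lambda>\<eta>. measure_pmf.expectation (\<pi> \<eta>) (\<lambda>q. h (real q / \<tau> \<eta>))) \<longlongrightarrow>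
          integral\<^sup>L (uniform_measure lborel {0..t_star}) h) at_top"
      proof (rule queue_uniform_limit[where \<epsilon>=\<epsilon> and \<psi>=\<psi> and c=c and H=1,
            OF ev_queue ev_integrable ev_pos \<tau>_top \<kappa> ev_surplus])
        show "\<exists>k>0. \<forall>\<^sub>F \<eta> in at_top. \<forall>q. \<epsilon> \<eta> * \<psi> (real q / \<tau> \<eta>) < k \<longrightarrow>
            \<bar>stationary_queue.net_square (A \<eta>) (S \<eta>) q - 2 * c\<bar> \<le> e" if e: "0 < e" for e
        proof -
          obtain k where k: "0 < k" and ns: "\<And>\<eta> q. 0 < \<eta> \<Longrightarrow> \<bar>\<epsilon> \<eta> * \<phi>c (real q / \<tau> \<eta>)\<bar> < k \<Longrightarrow>
            \<bar>\<epsilon> \<eta> * \<phi>s (real q / \<tau> \<eta>)\<bar> < k \<Longrightarrow> \<bar>stationary_queue.net_square (A \<eta>) (S \<eta>) q - 2 * c\<bar> \<le> e"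
            using noise[OF e] by blast
          have "\<bar>stationary_queue.net_square (A \<eta>) (S \<eta>) q - 2 * c\<bar> \<le> e"
            if \<eta>: "0 < \<eta>" and small: "\<epsilon> \<eta> * \<psi> (real q / \<tau> \<eta>) < k" for \<eta> q
          proof (rule ns[OF \<eta>])
            have "0 \<le> real q / \<tau> \<eta>" using pos(2)[OF \<eta>] by simp
            note dom = dominated[OF this]
            show "\<bar>\<epsilon> \<eta> * \<phi>c (real q / \<tau> \<eta>)\<bar> < k" "\<bar>\<epsilon> \<eta> * \<phi>s (real q / \<tau> \<eta>)\<bar> < k"
              unfolding abs_mult abs_of_pos[OF pos(1)[OF \<eta>]]
              using mult_left_mono[OF dom(1) less_imp_le[OF pos(1)[OF \<eta>]]]
                mult_left_mono[OF dom(2) less_imp_le[OF pos(1)[OF \<eta>]]] small by linarith+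
          qed
          then show ?thesis using k by (intro exI[of _ k] conjI ev) auto
        qed
      qed (use c t h \<psi>_mono vanish' \<psi>_pos uniformly_continuous_imp_continuous[OF h(1)] in simp_all)
    qed
  qed
  show ?thesis using part1 part2 part3 by blast
qed

end
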